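(* Let $r>1$ be an integer. For any $q\in(0,1)$ and any i.i.d. sequence of pairs $\{(U_n,V_n)\}_{n\ge0}$ of nonnegative finite random variables, the discrete-time Markov chain $\{\underline{W}^R_n\}_{n\ge0}$ on $\mathbb{S}=\{\underline{x}\in\mathbb{R}^r:0\le x_1\le\cdots\le x_r\}$ defined by $$\underline{W}^R_{n+1}=\begin{cases}\underline{0},&\text{with probability }q,\\ \big[\mathcal{R}(\underline{W}^R_n+V_n\underline{e}^{(1)})-U_n\underline{1}\big]^+,&\text{with probability }1-q,\end{cases}$$ is Harris ergodic.
   Context: $\underline{0}=(0,\dots,0)$, $\underline{1}=(1,\dots,1)$, $\underline{e}^{(1)}=(1,0,\dots,0)$ in $\mathbb{R}^r$. $\mathcal{R}(\underline{y})$ is the vector with the same entries as $\underline{y}$ re-arranged in non-decreasing order; $[\underline{y}]^+$ replaces negative entries by $0$. The choice between the two alternatives at each step is made independently of everything else up to that step. $U_n$ is the time between the $n$th and $(n+1)$st arrival, $V_n$ the service time of the $n$th arrival in a first-come first-served GI/GI/$r$ queue, and $\underline{W}^R_n$ the ordered residual workload vector at the $n$th arrival. Harris ergodic means positive Harris recurrent and aperiodic. *)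

theory Defs
  imports "HOL-Probability.Probability"
begin

text \<open>
  Independence of two random variables with different value types; the library constant
  \<open>indep_var\<close> requires a common one.
\<close>

definition indep_pair ::
  "'a measure \<Rightarrow> 'b measure \<Rightarrow> ('a \<Rightarrow> 'b) \<Rightarrow> 'c measure \<Rightarrow> ('a \<Rightarrow> 'c) \<Rightarrow> bool" where
  "indep_pair M N\<^sub>1 X N\<^sub>2 Y \<longleftrightarrow>
     X \<in> M \<rightarrow>\<^sub>M N\<^sub>1 \<and> Y \<in> M \<rightarrow>\<^sub>M N\<^sub>2 \<and>
     prob_space.indep_set M {X -` A \<inter> space M |A. A \<in> sets N\<^sub>1}
                            {Y -` B \<inter> space M |B. B \<in> sets N\<^sub>2}"

section \<open>Markov chains on a general measurable space\<close>

definition markov_kernel :: "'s measure \<Rightarrow> ('s \<Rightarrow> 's measure) \<Rightarrow> bool" where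
  "markov_kernel X K \<longleftrightarrow> K \<in> X \<rightarrow>\<^sub>M prob_algebra X"

text \<open>The \<open>\<sigma>\<close>-algebra generated by \<open>W 0, \<dots>, W n\<close>.\<close>

definition history :: "'a measure \<Rightarrow> 's measure \<Rightarrow> (nat \<Rightarrow> 'a \<Rightarrow> 's) \<Rightarrow> nat \<Rightarrow> 'a measure" where
  "history M X W n =
     vimage_algebra (space M) (\<lambda>\<omega>. \<lambda>i\<in>{..n}. W i \<omega>) (PiM {..n} (\<lambda>_. X))"

definition markov_chain ::
  "'a measure \<Rightarrow> 's measure \<Rightarrow> ('s \<Rightarrow> 's measure) \<Rightarrow> (nat \<Rightarrow> 'a \<Rightarrow> 's) \<Rightarrow> bool" where
  "markov_chain M X K W \<longleftrightarrow>
     prob_space M \<and> markov_kernel X K \<and> (\<forall>n. W n \<in> M \<rightarrow>\<^sub>M X) \<and>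
     (\<forall>n. \<forall>A\<in>sets X. AE \<omega> in M.
        real_cond_exp M (history M X W n) (\<lambda>\<omega>. indicator A (W (Suc n) \<omega>)) \<omega>
          = measure (K (W n \<omega>)) A)"

text \<open>
  The canonical law \<open>P\<^sub>x\<close>, on the path space, of the chain with kernel \<open>K\<close> started at \<open>x\<close>,
  from the Ionescu-Tulcea theorem. The first argument of the one-step kernels is the time
  of the coordinate to be drawn, the second the path up to but excluding that time.
\<close>

definition path_law :: "'s measure \<Rightarrow> ('s \<Rightarrow> 's measure) \<Rightarrow> 's \<Rightarrow> (nat \<Rightarrow> 's) measure" where
  "path_law X K x =
     projective_family.lim UNIV
       (Ionescu_Tulcea.CI (\<lambda>n \<omega>. case n of 0 \<Rightarrow> return X x | Suc m \<Rightarrow> K (\<omega> m)) (\<lambda>_. X))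
       (\<lambda>_. X)"

text \<open>The notions below follow Meyn and Tweedie, \<^emph>\<open>Markov Chains and Stochastic Stability\<close>.\<close>

definition irreducibility_measure ::
  "'s measure \<Rightarrow> ('s \<Rightarrow> 's measure) \<Rightarrow> 's measure \<Rightarrow> bool" where
  "irreducibility_measure X K \<phi> \<longleftrightarrow>
     sets \<phi> = sets X \<and> sigma_finite_measure \<phi> \<and> emeasure \<phi> (space X) \<noteq> 0 \<and>
     (\<forall>A\<in>sets X. emeasure \<phi> A > 0 \<longrightarrow>
        (\<forall>x\<in>space X.
           measure (path_law X K x) {\<omega> \<in> space (path_law X K x). \<exists>n\<ge>1. \<omega> n \<in> A} > 0))"

definition maximal_irreducibility_measure ::
  "'s measure \<Rightarrow> ('s \<Rightarrow> 's measure) \<Rightarrow> 's measure \<Rightarrow> bool" where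
  "maximal_irreducibility_measure X K \<psi> \<longleftrightarrow>
     irreducibility_measure X K \<psi> \<and>
     (\<forall>\<phi>. irreducibility_measure X K \<phi> \<longrightarrow> absolutely_continuous \<psi> \<phi>)"

text \<open>
  Any two maximal irreducibility measures have the same null sets, so that in the
  definitions of Harris recurrence and of aperiodicity the choice of \<open>\<psi>\<close> is immaterial.
  Infinitely many visits to \<open>A\<close> are required from every starting state, not only from those in \<open>A\<close>.
\<close>

definition harris_recurrent :: "'s measure \<Rightarrow> ('s \<Rightarrow> 's measure) \<Rightarrow> bool" where
  "harris_recurrent X K \<longleftrightarrow>
     (\<exists>\<psi>. maximal_irreducibility_measure X K \<psi> \<and>
       (\<forall>A\<in>sets X. emeasure \<psi> A > 0 \<longrightarrow>
          (\<forall>x\<in>space X.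
             measure (path_law X K x)
               {\<omega> \<in> space (path_law X K x). infinite {n. \<omega> n \<in> A}} = 1)))"

definition invariant_probability ::
  "'s measure \<Rightarrow> ('s \<Rightarrow> 's measure) \<Rightarrow> 's measure \<Rightarrow> bool" where
  "invariant_probability X K \<pi> \<longleftrightarrow>
     sets \<pi> = sets X \<and> prob_space \<pi> \<and> bind \<pi> K = \<pi>"

definition positive_harris_recurrent :: "'s measure \<Rightarrow> ('s \<Rightarrow> 's measure) \<Rightarrow> bool" where
  "positive_harris_recurrent X K \<longleftrightarrow>
     harris_recurrent X K \<and> (\<exists>\<pi>. invariant_probability X K \<pi>)"

definition cycle ::
  "'s measure \<Rightarrow> ('s \<Rightarrow> 's measure) \<Rightarrow> 's measure \<Rightarrow> nat \<Rightarrow> (nat \<Rightarrow> 's set) \<Rightarrow> bool" where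
  "cycle X K \<psi> d D \<longleftrightarrow>
     d \<ge> 1 \<and> (\<forall>i<d. D i \<in> sets X) \<and> disjoint_family_on D {..<d} \<and>
     (\<forall>i<d. \<forall>x\<in>D i. measure (K x) (D (Suc i mod d)) = 1) \<and>
     emeasure \<psi> (space X - (\<Union>i<d. D i)) = 0"

definition aperiodic :: "'s measure \<Rightarrow> ('s \<Rightarrow> 's measure) \<Rightarrow> bool" where
  "aperiodic X K \<longleftrightarrow>
     (\<exists>\<psi>. maximal_irreducibility_measure X K \<psi> \<and> (\<forall>d D. cycle X K \<psi> d D \<longrightarrow> d = 1))"

definition harris_ergodic :: "'s measure \<Rightarrow> ('s \<Rightarrow> 's measure) \<Rightarrow> bool" where
  "harris_ergodic X K \<longleftrightarrow>
     markov_kernel X K \<and> positive_harris_recurrent X K \<and> aperiodic X K"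

section \<open>The workload vector of a FCFS GI/GI/r queue with random clearing\<close>

text \<open>
  Vectors of \<open>\<real>\<^sup>r\<close> are the extensional functions on \<open>{..<r}\<close>: the component written
  \<open>x\<^sub>i\<close> on paper is \<open>x (i - 1)\<close>. The product \<open>\<sigma>\<close>-algebra is the Borel one.
\<close>

definition workload_space :: "nat \<Rightarrow> (nat \<Rightarrow> real) measure" where
  "workload_space r =
     restrict_space (PiM {..<r} (\<lambda>_. borel))
       {x. (\<forall>i<r. 0 \<le> x i) \<and> (\<forall>i j. i \<le> j \<and> j < r \<longrightarrow> x i \<le> x j)}"

definition zero_vec :: "nat \<Rightarrow> nat \<Rightarrow> real" where
  "zero_vec r = (\<lambda>i\<in>{..<r}. 0)"

definition rearrange :: "nat \<Rightarrow> (nat \<Rightarrow> real) \<Rightarrow> nat \<Rightarrow> real" where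
  "rearrange r y = (\<lambda>i\<in>{..<r}. sort (map y [0..<r]) ! i)"

text \<open>\<open>[R(x + v e\<^sup>(\<^sup>1\<^sup>)) - u 1]\<^sup>+\<close>, with \<open>u\<close> the interarrival and \<open>v\<close> the service time.\<close>

definition queue_step :: "nat \<Rightarrow> real \<Rightarrow> real \<Rightarrow> (nat \<Rightarrow> real) \<Rightarrow> nat \<Rightarrow> real" where
  "queue_step r u v x = (\<lambda>i\<in>{..<r}. max 0 (rearrange r (x(0 := x 0 + v)) i - u))"

text \<open>Transition kernel of the cleared chain; \<open>D\<close> is the joint law of a pair \<open>(U, V)\<close>.\<close>

definition clearing_kernel ::
  "nat \<Rightarrow> real \<Rightarrow> (real \<times> real) measure \<Rightarrow> (nat \<Rightarrow> real) \<Rightarrow> (nat \<Rightarrow> real) measure" where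
  "clearing_kernel r q D x =
     bind (measure_pmf (bernoulli_pmf q))
       (\<lambda>clear. if clear then return (workload_space r) (zero_vec r)
                else distr D (workload_space r) (\<lambda>(u, v). queue_step r u v x))"

end

theory Submission
  imports Defs
begin

text \<open>
  From every state the chain jumps to \<open>0\<close> with probability \<open>q\<close>. Writing \<open>Q\<close> for the kernel of the
  queue without clearing, the times between clearings are geometric, so the law
  \<open>\<pi> = \<Sum>n. q (1 - q)\<^sup>n \<delta>\<^sub>0 Q\<^sup>n\<close> is invariant. If \<open>\<pi> A > 0\<close>, then \<open>\<delta>\<^sub>0 Q\<^sup>n A > 0\<close> for
  some \<open>n\<close>, and a clearing followed by \<open>n\<close> steps of \<open>Q\<close> leads to \<open>A\<close> with a probability bounded below
  uniformly in the starting state; hence \<open>A\<close> is visited infinitely often almost surely. This makes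
  \<open>\<pi>\<close> an irreducibility measure, and it is maximal because \<open>\<pi>\<close> is invariant and charges \<open>0\<close>.
  Aperiodicity holds since \<open>0\<close> can follow \<open>0\<close>.
\<close>

section \<open>Path laws of Markov kernels\<close>

text \<open>The kernel as an operator on nonnegative functions. Its iterates
  \<open>kernel_op K ^^ n\<close> stand in for the \<open>n\<close>-step kernels throughout.\<close>

definition kernel_op :: "('s \<Rightarrow> 's measure) \<Rightarrow> ('s \<Rightarrow> ennreal) \<Rightarrow> 's \<Rightarrow> ennreal" where
  "kernel_op K g x = (\<integral>\<^sup>+y. g y \<partial>K x)"

lemma markov_kernelD:
  assumes "markov_kernel X K"
  shows "K \<in> X \<rightarrow>\<^sub>M prob_algebra X" "K \<in> X \<rightarrow>\<^sub>M subprob_algebra X"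
    and "x \<in> space X \<Longrightarrow> prob_space (K x)" "x \<in> space X \<Longrightarrow> sets (K x) = sets X"
    and "x \<in> space X \<Longrightarrow> space (K x) = space X"
proof -
  show K: "K \<in> X \<rightarrow>\<^sub>M prob_algebra X"
    using assms by (simp add: markov_kernel_def)
  then show K': "K \<in> X \<rightarrow>\<^sub>M subprob_algebra X"
    by (rule measurable_prob_algebraD)
  show "x \<in> space X \<Longrightarrow> prob_space (K x)"
    using measurable_space[OF K] by (simp add: space_prob_algebra)
  show "x \<in> space X \<Longrightarrow> sets (K x) = sets X" "x \<in> space X \<Longrightarrow> space (K x) = space X"
    using K' by (auto dest: subprob_measurableD)
qed

lemma measurable_kernel_op:
  assumes "markov_kernel X K" and "g \<in> borel_measurable X"
  shows "kernel_op K g \<in> borel_measurable X"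
  unfolding kernel_op_def
  by (rule measurable_compose[OF markov_kernelD(2) nn_integral_measurable_subprob_algebra]) fact+

lemma measurable_kernel_op_pow:
  assumes "markov_kernel X K" and "g \<in> borel_measurable X"
  shows "(kernel_op K ^^ n) g \<in> borel_measurable X"
  by (induction n) (simp_all add: assms measurable_kernel_op)

text \<open>Makes the facts about the Ionescu-Tulcea construction available for
  \<open>path_law\<close>. The start \<open>x\<close> must lie in the state space for the law of
  coordinate 0, \<open>return X x\<close>, to be a probability measure.\<close>

lemma Ionescu_Tulcea_kernel:
  assumes K: "markov_kernel X K" and x: "x \<in> space X"
  shows "Ionescu_Tulcea (\<lambda>n \<omega>. case n of 0 \<Rightarrow> return X x | Suc m \<Rightarrow> K (\<omega> m)) (\<lambda>_. X)"
proof (rule Ionescu_Tulcea.intro)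
  fix i :: nat
  show "(\<lambda>\<omega>. case i of 0 \<Rightarrow> return X x | Suc m \<Rightarrow> K (\<omega> m)) \<in> PiM {0..<i} (\<lambda>_. X) \<rightarrow>\<^sub>M subprob_algebra X"
  proof (cases i)
    case 0
    have "return X x \<in> space (subprob_algebra X)"
      using x by (simp add: space_subprob_algebra prob_space_return prob_space_imp_subprob_space)
    with 0 show ?thesis by simp
  next
    case (Suc m)
    with measurable_compose[OF measurable_component_singleton[of m "{0..<i}" "\<lambda>_. X"] markov_kernelD(2)[OF K]]
    show ?thesis by simp
  qed
  fix \<omega> assume "\<omega> \<in> space (PiM {0..<i} (\<lambda>_. X))"
  then show "prob_space (case i of 0 \<Rightarrow> return X x | Suc m \<Rightarrow> K (\<omega> m))"
    using x by (auto simp: space_PiM PiE_iff prob_space_return intro!: markov_kernelD(3)[OF K] split: nat.split)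
qed

section \<open>Marginals and Markov property of the canonical path law\<close>

context
  fixes X :: "'s measure" and K :: "'s \<Rightarrow> 's measure" and x :: 's
  assumes K: "markov_kernel X K" and x: "x \<in> space X"
begin

interpretation IT: Ionescu_Tulcea "\<lambda>n \<omega>. case n of 0 \<Rightarrow> return X x | Suc m \<Rightarrow> K (\<omega> m)" "\<lambda>_. X"
  using K x by (rule Ionescu_Tulcea_kernel)

lemma path_law_eq_lim: "path_law X K x = IT.PF.lim"
  by (simp add: path_law_def)

lemma sets_path_law [measurable_cong]: "sets (path_law X K x) = sets (PiM UNIV (\<lambda>_. X))"
  and space_path_law: "space (path_law X K x) = space (PiM UNIV (\<lambda>_. X))"
  by (simp_all add: path_law_eq_lim)

lemma distr_path_law_prefix:
  "distr (path_law X K x) (PiM {0..<n} (\<lambda>_. X)) (\<lambda>\<omega>. restrict \<omega> {0..<n}) = IT.C 0 n (\<lambda>_. undefined)"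
proof -
  \<comment> \<open>The finite-dimensional laws of the limit are computed by running the
    construction up to the least bound of the index set. For an initial segment nothing beyond it is
    drawn, so the marginal is the plain composition of the first \<open>n\<close> kernels.\<close>
  have "IT.up_to {0..<n} = n"
    using IT.up_to_iff[of "{0..<n}" n] IT.up_to_iff[of "{0..<n}" "IT.up_to {0..<n}"]
    by (cases n) (auto intro!: antisym simp: Suc_le_eq)
  then show ?thesis
    using IT.distr_C[of n n "\<lambda>_. undefined" 0]
    by (simp add: path_law_eq_lim IT.distr_lim IT.CI_def space_PiM)
qed

lemma prob_space_path_law: "prob_space (path_law X K x)"
proof (rule prob_space_distrD)
  \<comment> \<open>Image measures keep the total mass, so the projection to no coordinates at all
    is enough.\<close>
  show "(\<lambda>\<omega>. restrict \<omega> {0..<0}) \<in> path_law X K x \<rightarrow>\<^sub>M PiM {0..<0} (\<lambda>_. X)"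
    by measurable
  show "prob_space (distr (path_law X K x) (PiM {0..<0} (\<lambda>_. X)) (\<lambda>\<omega>. restrict \<omega> {0..<0}))"
    unfolding distr_path_law_prefix by (rule IT.prob_space_C) (simp add: space_PiM)
qed

lemma nn_integral_path_law_prefix:
  assumes [measurable]: "f \<in> borel_measurable (PiM {0..<n} (\<lambda>_. X))"
  shows "(\<integral>\<^sup>+\<omega>. f (restrict \<omega> {0..<n}) \<partial>path_law X K x) = (\<integral>\<^sup>+\<omega>. f \<omega> \<partial>IT.C 0 n (\<lambda>_. undefined))"
  unfolding distr_path_law_prefix[symmetric]
  by (subst nn_integral_distr) (auto simp: assms intro!: measurable_restrict)

lemma nn_integral_path_law_0:
  assumes [measurable]: "g \<in> borel_measurable X"
  shows "(\<integral>\<^sup>+\<omega>. g (\<omega> 0) \<partial>path_law X K x) = g x"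
proof -
  have und: "(\<lambda>_. undefined) \<in> space (PiM {0..<0::nat} (\<lambda>_. X))"
    by (simp add: space_PiM)
  have [measurable]: "(\<lambda>\<omega>. g (\<omega> 0)) \<in> borel_measurable (PiM {0..<Suc 0} (\<lambda>_. X))"
    by measurable
  have "(\<integral>\<^sup>+\<omega>. g (\<omega> 0) \<partial>path_law X K x) = (\<integral>\<^sup>+\<omega>. g (\<omega> 0) \<partial>IT.C 0 (Suc 0) (\<lambda>_. undefined))"
    using nn_integral_path_law_prefix[of "\<lambda>\<omega>. g (\<omega> 0)" "Suc 0"] by simp
  also have "\<dots> = (\<integral>\<^sup>+\<omega>. g (\<omega> 0) \<partial>IT.eP 0 (\<lambda>_. undefined))"
    by (simp only: IT.C.simps add_0_left bind_return[OF IT.measurable_eP und])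
  also have "\<dots> = g x"
    using und x by (subst IT.nn_integral_eP) (auto simp: nn_integral_return)
  finally show ?thesis .
qed

text \<open>The Markov property in integrated form: \<open>f\<close> sees only the times up to
  \<open>n\<close>, so it is constant while coordinate \<open>Suc n\<close>, drawn from
  \<open>K (\<omega> n)\<close>, is integrated out.\<close>

lemma nn_integral_path_law_Suc:
  assumes [measurable]: "f \<in> borel_measurable (PiM {0..<Suc n} (\<lambda>_. X))" "g \<in> borel_measurable X"
  shows "(\<integral>\<^sup>+\<omega>. f (restrict \<omega> {0..<Suc n}) * g (\<omega> (Suc n)) \<partial>path_law X K x) =
         (\<integral>\<^sup>+\<omega>. f (restrict \<omega> {0..<Suc n}) * kernel_op K g (\<omega> n) \<partial>path_law X K x)"
proof -
  let ?u = "\<lambda>_. undefined" and ?P = "\<lambda>n::nat. PiM {0..<n} (\<lambda>_. X)"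
  have und: "?u \<in> space (?P 0)"
    by (simp add: space_PiM)
  have [measurable]: "kernel_op K g \<in> borel_measurable X"
    by (rule measurable_kernel_op[OF K]) measurable
  have res [measurable]: "(\<lambda>\<omega>. restrict \<omega> {0..<Suc n}) \<in> ?P (Suc (Suc n)) \<rightarrow>\<^sub>M ?P (Suc n)"
    by (rule measurable_restrict_subset) auto
  have "(\<integral>\<^sup>+\<omega>. f (restrict \<omega> {0..<Suc n}) * g (\<omega> (Suc n)) \<partial>path_law X K x) =
        (\<integral>\<^sup>+\<omega>. f (restrict \<omega> {0..<Suc n}) * g (\<omega> (Suc n)) \<partial>IT.C 0 (Suc (Suc n)) ?u)"
    using nn_integral_path_law_prefix[of "\<lambda>\<omega>. f (restrict \<omega> {0..<Suc n}) * g (\<omega> (Suc n))" "Suc (Suc n)"]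
    by (simp add: Int_absorb1 cong: restrict_cong)
  also have "\<dots> = (\<integral>\<^sup>+\<omega>. (\<integral>\<^sup>+\<omega>'. f (restrict \<omega>' {0..<Suc n}) * g (\<omega>' (Suc n)) \<partial>IT.eP (Suc n) \<omega>) \<partial>IT.C 0 (Suc n) ?u)"
    using IT.measurable_eP[of "Suc n"] IT.sets_C[OF und, of "Suc n"]
    unfolding IT.C.simps(2)[of 0 "Suc n"]
    by (subst nn_integral_bind[where B="?P (Suc (Suc n))"]) (auto cong: measurable_cong_sets)
  also have "\<dots> = (\<integral>\<^sup>+\<omega>. f \<omega> * kernel_op K g (\<omega> n) \<partial>IT.C 0 (Suc n) ?u)"
  proof (rule nn_integral_cong)
    fix \<omega> assume "\<omega> \<in> space (IT.C 0 (Suc n) ?u)"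
    then have \<omega>: "\<omega> \<in> space (?P (Suc n))"
      using IT.space_C[OF und, of "Suc n"] by simp
    then have wn: "\<omega> n \<in> space X"
      by (auto simp: space_PiM)
    \<comment> \<open>Cutting off the coordinate just drawn restores the old prefix, which is why
      \<open>f\<close> comes out of the inner integral.\<close>
    have eq: "restrict (fun_upd \<omega> (Suc n) y) {0..<Suc n} = \<omega>" for y
      using \<omega> by (auto simp: space_PiM PiE_iff extensional_def fun_eq_iff)
    have "(\<integral>\<^sup>+\<omega>'. f (restrict \<omega>' {0..<Suc n}) * g (\<omega>' (Suc n)) \<partial>IT.eP (Suc n) \<omega>) =
          (\<integral>\<^sup>+y. f \<omega> * g y \<partial>K (\<omega> n))"
      using \<omega> by (subst IT.nn_integral_eP) (auto simp: eq simp del: restrict_apply)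
    also have "\<dots> = f \<omega> * kernel_op K g (\<omega> n)"
      using markov_kernelD(4)[OF K wn] unfolding kernel_op_def
      by (intro nn_integral_cmult) (simp cong: measurable_cong_sets)
    finally show "(\<integral>\<^sup>+\<omega>'. f (restrict \<omega>' {0..<Suc n}) * g (\<omega>' (Suc n)) \<partial>IT.eP (Suc n) \<omega>) =
      f \<omega> * kernel_op K g (\<omega> n)" .
  qed
  also have "\<dots> = (\<integral>\<^sup>+\<omega>. f (restrict \<omega> {0..<Suc n}) * kernel_op K g (\<omega> n) \<partial>path_law X K x)"
    using nn_integral_path_law_prefix[of "\<lambda>\<omega>. f \<omega> * kernel_op K g (\<omega> n)" "Suc n"]
    by simp
  finally show ?thesis .
qed

text \<open>The last of the \<open>Suc k\<close> steps is removed first: \<open>f\<close> is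
  regarded as a function of the longer prefix up to time \<open>n + k\<close>, and the induction
  hypothesis for \<open>kernel_op K g\<close> does the rest.\<close>

lemma nn_integral_path_law_add:
  assumes f: "f \<in> borel_measurable (PiM {0..<Suc n} (\<lambda>_. X))" and g: "g \<in> borel_measurable X"
  shows "(\<integral>\<^sup>+\<omega>. f (restrict \<omega> {0..<Suc n}) * g (\<omega> (n + k)) \<partial>path_law X K x) =
         (\<integral>\<^sup>+\<omega>. f (restrict \<omega> {0..<Suc n}) * (kernel_op K ^^ k) g (\<omega> n) \<partial>path_law X K x)"
  using g
proof (induction k arbitrary: g)
  case (Suc k)
  have [measurable]: "(\<lambda>\<omega>. restrict \<omega> {0..<Suc n}) \<in> PiM {0..<Suc (n + k)} (\<lambda>_. X) \<rightarrow>\<^sub>M PiM {0..<Suc n} (\<lambda>_. X)"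
    by (rule measurable_restrict_subset) auto
  have *: "{0..<Suc (n + k)} \<inter> {0..<Suc n} = {0..<Suc n}"
    by auto
  have "(\<lambda>\<omega>. f (restrict \<omega> {0..<Suc n})) \<in> borel_measurable (PiM {0..<Suc (n + k)} (\<lambda>_. X))"
    using f by measurable
  from nn_integral_path_law_Suc[OF this Suc.prems]
  have "(\<integral>\<^sup>+\<omega>. f (restrict \<omega> {0..<Suc n}) * g (\<omega> (n + Suc k)) \<partial>path_law X K x) =
        (\<integral>\<^sup>+\<omega>. f (restrict \<omega> {0..<Suc n}) * kernel_op K g (\<omega> (n + k)) \<partial>path_law X K x)"
    by (simp add: *)
  also have "\<dots> = (\<integral>\<^sup>+\<omega>. f (restrict \<omega> {0..<Suc n}) * (kernel_op K ^^ k) (kernel_op K g) (\<omega> n) \<partial>path_law X K x)"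
    by (rule Suc.IH) (rule measurable_kernel_op[OF K Suc.prems])
  finally show ?case
    by (simp only: funpow.simps comp_apply funpow_swap1)
qed simp

lemma emeasure_path_law_at:
  assumes A [measurable]: "A \<in> sets X"
  shows "emeasure (path_law X K x) {\<omega> \<in> space (path_law X K x). \<omega> n \<in> A} = (kernel_op K ^^ n) (indicator A) x"
proof -
  have "emeasure (path_law X K x) {\<omega> \<in> space (path_law X K x). \<omega> n \<in> A} =
        (\<integral>\<^sup>+\<omega>. indicator A (\<omega> n) \<partial>path_law X K x)"
    by (auto simp flip: nn_integral_indicator intro!: nn_integral_cong split: split_indicator)
  also have "\<dots> = (kernel_op K ^^ n) (indicator A) x"
    using nn_integral_path_law_add[of "\<lambda>_. 1" 0 "indicator A" n]
      nn_integral_path_law_0[OF measurable_kernel_op_pow[OF K], of "indicator A" n]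
    by simp
  finally show ?thesis .
qed

text \<open>A uniform lower bound on the \<open>k\<close>-step probability of \<open>A\<close> makes the probability of avoiding
  \<open>A\<close> at the times \<open>n + k, n + 2 k, \<dots>\<close> decay geometrically, whatever \<open>n\<close>.\<close>

lemma path_law_infinitely_often:
  assumes A [measurable]: "A \<in> sets X" and e: "0 < e"
    and min: "\<And>y. y \<in> space X \<Longrightarrow> ennreal e \<le> (kernel_op K ^^ k) (indicator A) y"
  shows "measure (path_law X K x) {\<omega> \<in> space (path_law X K x). infinite {n. \<omega> n \<in> A}} = 1"
proof -
  let ?P = "path_law X K x"
  interpret prob_space ?P
    by (rule prob_space_path_law)
  \<comment> \<open>A single visit along each progression suffices, because the progression may
    start arbitrarily late.\<close>
  have null: "AE \<omega> in ?P. \<exists>j. \<omega> (n + k * j) \<in> A" if "n > 0" for n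
  proof -
    define B where "B i = {\<omega> \<in> space ?P. \<forall>j\<le>i. \<omega> (n + k * j) \<notin> A}" for i
    have [measurable]: "B i \<in> sets ?P" for i
      unfolding B_def by measurable
    \<comment> \<open>By the Markov property at time \<open>n + k * i\<close>, the part of
      \<open>B i\<close> that is in \<open>A\<close> at the next sampled time has probability at
      least \<open>e * prob (B i)\<close>. This part is exactly
      \<open>B i - B (Suc i)\<close>.\<close>
    have step: "prob (B (Suc i)) \<le> (1 - e) * prob (B i)" for i
    proof -
      let ?t = "n + k * i"
      define f :: "(nat \<Rightarrow> 's) \<Rightarrow> ennreal" where
        "f \<omega> = (if \<forall>j\<le>i. \<omega> (n + k * j) \<notin> A then 1 else 0)" for \<omega>
      have t: "n + k * Suc i = ?t + k"
        by simp
      have f: "f \<in> borel_measurable (PiM {0..<Suc ?t} (\<lambda>_. X))"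
      proof -
        have [measurable]: "(\<lambda>\<omega>. \<omega> (n + k * j)) \<in> PiM {0..<Suc ?t} (\<lambda>_. X) \<rightarrow>\<^sub>M X" if "j \<le> i" for j
          by (rule measurable_component_singleton) (use that in \<open>simp add: less_Suc_eq_le\<close>)
        show ?thesis unfolding f_def by measurable
      qed
      have fB: "f (restrict \<omega> {0..<Suc ?t}) = indicator (B i) \<omega>" if "\<omega> \<in> space ?P" for \<omega>
        using that by (auto simp: f_def B_def less_Suc_eq_le split: split_indicator)
      have "ennreal e * emeasure ?P (B i) = (\<integral>\<^sup>+\<omega>. indicator (B i) \<omega> * ennreal e \<partial>?P)"
        by (subst nn_integral_multc) (simp_all add: mult.commute)
      also have "\<dots> \<le> (\<integral>\<^sup>+\<omega>. f (restrict \<omega> {0..<Suc ?t}) * (kernel_op K ^^ k) (indicator A) (\<omega> ?t) \<partial>?P)"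
        by (intro nn_integral_mono) (auto simp: fB space_path_law space_PiM intro!: mult_left_mono min)
      also have "\<dots> = (\<integral>\<^sup>+\<omega>. f (restrict \<omega> {0..<Suc ?t}) * indicator A (\<omega> (?t + k)) \<partial>?P)"
        by (rule nn_integral_path_law_add[OF f, symmetric]) simp
      also have "\<dots> = (\<integral>\<^sup>+\<omega>. indicator (B i - B (Suc i)) \<omega> \<partial>?P)"
        by (intro nn_integral_cong)
           (auto simp: fB B_def le_Suc_eq t simp del: mult_Suc_right split: split_indicator)
      also have "\<dots> = emeasure ?P (B i - B (Suc i))"
        by simp
      finally have "ennreal (e * prob (B i)) \<le> ennreal (prob (B i - B (Suc i)))"
        using e by (simp add: emeasure_eq_measure ennreal_mult)
      then have "e * prob (B i) \<le> prob (B i - B (Suc i))"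
        by simp
      also have "\<dots> = prob (B i) - prob (B (Suc i))"
        by (rule finite_measure_Diff) (auto simp: B_def)
      finally show ?thesis
        by (simp add: algebra_simps)
    qed
    \<comment> \<open>Truncating the factor at 0 makes it a nonnegative multiplier, as the induction
      requires.\<close>
    have le: "prob (B i) \<le> (max 0 (1 - e)) ^ i" for i
    proof (induction i)
      case (Suc i)
      have "prob (B (Suc i)) \<le> max 0 (1 - e) * prob (B i)"
        using step[of i] by (rule order_trans) (simp add: mult_right_mono)
      also have "\<dots> \<le> max 0 (1 - e) * max 0 (1 - e) ^ i"
        by (intro mult_left_mono Suc.IH) simp
      finally show ?case by simp
    qed simp
    define N where "N = {\<omega> \<in> space ?P. \<forall>j. \<omega> (n + k * j) \<notin> A}"
    have [measurable]: "N \<in> sets ?P"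
      unfolding N_def by measurable
    have "prob N \<le> max 0 (1 - e) ^ i" for i
    proof -
      have "prob N \<le> prob (B i)"
        by (rule finite_measure_mono) (auto simp: N_def B_def)
      with le[of i] show ?thesis by simp
    qed
    moreover have "(\<lambda>i. max 0 (1 - e) ^ i) \<longlonglongrightarrow> 0"
      using e by (intro LIMSEQ_realpow_zero) auto
    ultimately have "prob N \<le> 0"
      by (intro LIMSEQ_le_const) auto
    then have "emeasure ?P N = 0"
      by (simp add: emeasure_eq_measure antisym)
    then show ?thesis
      by (intro AE_I[where N=N]) (auto simp: N_def)
  qed
  have "AE \<omega> in ?P. \<forall>n>0. \<exists>j. \<omega> (n + k * j) \<in> A"
    using null by (auto simp: AE_all_countable)
  then have "AE \<omega> in ?P. infinite {n. \<omega> n \<in> A}"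
  proof eventually_elim
    case (elim \<omega>)
    \<comment> \<open>Given a bound \<open>m\<close>, the progression started at
      \<open>n = Suc m\<close> provides a visit after time \<open>m\<close>.\<close>
    then show ?case
      unfolding infinite_nat_iff_unbounded mem_Collect_eq
      by (metis add.commute trans_less_add2 lessI zero_less_Suc)
  qed
  moreover have "{\<omega> \<in> space ?P. infinite {n. \<omega> n \<in> A}} \<in> sets ?P"
    unfolding infinite_nat_iff_unbounded mem_Collect_eq by measurable
  ultimately show ?thesis
    by (simp add: prob_Collect_eq_1)
qed

end

section \<open>Kernels with an atom common to all one-step laws\<close>

text \<open>The assumption \<open>mixture\<close> is phrased through integrals because it is applied
  to iterates of \<open>kernel_op\<close>, not only to indicators of sets.\<close>

context
  fixes X :: "'s measure" and K Q :: "'s \<Rightarrow> 's measure" and z :: 's and q :: real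
  assumes K: "markov_kernel X K" and Q: "markov_kernel X Q" and z: "z \<in> space X"
    and q: "0 < q" "q \<le> 1"
    and mixture: "\<And>g x. g \<in> borel_measurable X \<Longrightarrow> x \<in> space X \<Longrightarrow>
      (\<integral>\<^sup>+y. g y \<partial>K x) = ennreal q * g z + ennreal (1 - q) * (\<integral>\<^sup>+y. g y \<partial>Q x)"
begin

section \<open>The law of an excursion from the atom and the invariant law\<close>

definition excursion :: "nat \<Rightarrow> 's measure" where
  "excursion n = ((\<lambda>\<nu>. bind \<nu> Q) ^^ n) (return X z)"

text \<open>The geometric variable is the time elapsed since the last jump to \<open>z\<close>.
  Given that it equals \<open>n\<close>, the state has the law \<open>excursion n\<close>, which is
  \<open>n\<close> steps of \<open>Q\<close> from \<open>z\<close>.\<close>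

definition stationary :: "'s measure" where
  "stationary = bind (measure_pmf (geometric_pmf q)) excursion"

lemma excursion_in_prob_algebra: "excursion n \<in> space (prob_algebra X)"
proof (induction n)
  case 0
  show ?case
    using z by (simp add: excursion_def space_prob_algebra prob_space_return)
next
  case (Suc n)
  then show ?case
    using prob_space_bind'[OF Suc markov_kernelD(1)[OF Q]] sets_bind'[OF Suc markov_kernelD(1)[OF Q]]
    by (simp add: excursion_def space_prob_algebra)
qed

text \<open>Duality: pushing the point mass at \<open>z\<close> forward along \<open>Q\<close>
  corresponds to pulling \<open>g\<close> back.\<close>

lemma nn_integral_excursion:
  assumes "g \<in> borel_measurable X"
  shows "(\<integral>\<^sup>+x. g x \<partial>excursion n) = (kernel_op Q ^^ n) g z"
  using assms
proof (induction n arbitrary: g)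
  case 0
  then show ?case
    using z by (simp add: excursion_def nn_integral_return)
next
  case (Suc n)
  have sets: "sets (excursion n) = sets X"
    using excursion_in_prob_algebra[of n] by (simp add: space_prob_algebra)
  have "(\<integral>\<^sup>+x. g x \<partial>excursion (Suc n)) = (\<integral>\<^sup>+x. g x \<partial>bind (excursion n) Q)"
    by (simp add: excursion_def)
  also have "\<dots> = (\<integral>\<^sup>+x. kernel_op Q g x \<partial>excursion n)"
    using markov_kernelD(2)[OF Q] Suc.prems sets unfolding kernel_op_def
    by (subst nn_integral_bind[where B=X]) (auto cong: measurable_cong_sets)
  also have "\<dots> = (kernel_op Q ^^ n) (kernel_op Q g) z"
    by (rule Suc.IH) (rule measurable_kernel_op[OF Q Suc.prems])
  finally show ?case
    by (simp only: funpow.simps comp_apply funpow_swap1)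
qed

lemma measurable_excursion: "excursion \<in> measure_pmf (geometric_pmf q) \<rightarrow>\<^sub>M prob_algebra X"
  using excursion_in_prob_algebra by (simp add: measurable_pmf_measure1 Pi_iff)

lemma stationary_in_prob_algebra: "stationary \<in> space (prob_algebra X)"
proof -
  have "measure_pmf (geometric_pmf q) \<in> space (prob_algebra (measure_pmf (geometric_pmf q)))"
    by (simp add: space_prob_algebra prob_space_measure_pmf)
  then show ?thesis
    using prob_space_bind'[OF _ measurable_excursion] sets_bind'[OF _ measurable_excursion]
    by (simp add: stationary_def space_prob_algebra)
qed

lemma nn_integral_stationary:
  assumes g: "g \<in> borel_measurable X"
  shows "(\<integral>\<^sup>+x. g x \<partial>stationary) = (\<Sum>n. ennreal ((1 - q) ^ n * q) * (kernel_op Q ^^ n) g z)"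
proof -
  have "(\<integral>\<^sup>+x. g x \<partial>stationary) = (\<integral>\<^sup>+n. (kernel_op Q ^^ n) g z \<partial>measure_pmf (geometric_pmf q))"
    unfolding stationary_def
    by (subst nn_integral_bind[OF g measurable_prob_algebraD[OF measurable_excursion]])
       (simp add: nn_integral_excursion[OF g])
  also have "\<dots> = (\<Sum>n. ennreal ((1 - q) ^ n * q) * (kernel_op Q ^^ n) g z)"
    using q by (simp add: nn_integral_measure_pmf nn_integral_count_space_nat)
  finally show ?thesis .
qed

text \<open>Invariance is a shift of the geometric series: the branch along \<open>Q\<close> raises
  each index by one, and the jump to \<open>z\<close> refills the term of index 0.\<close>

lemma nn_integral_kernel_op_stationary:
  assumes g: "g \<in> borel_measurable X"
  shows "(\<integral>\<^sup>+x. kernel_op K g x \<partial>stationary) = (\<integral>\<^sup>+x. g x \<partial>stationary)"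
proof -
  have sp: "prob_space stationary" "sets stationary = sets X" "space stationary = space X"
    using stationary_in_prob_algebra by (auto simp: space_prob_algebra dest: sets_eq_imp_space_eq)
  have Qg: "kernel_op Q g \<in> borel_measurable X"
    by (rule measurable_kernel_op[OF Q g])
  have "(\<integral>\<^sup>+x. kernel_op K g x \<partial>stationary) =
        (\<integral>\<^sup>+x. ennreal q * g z + ennreal (1 - q) * kernel_op Q g x \<partial>stationary)"
    by (intro nn_integral_cong) (simp add: sp kernel_op_def mixture[OF g])
  also have "\<dots> = ennreal q * g z + ennreal (1 - q) * (\<integral>\<^sup>+x. kernel_op Q g x \<partial>stationary)"
    using Qg sp(2) prob_space.emeasure_space_1[OF sp(1)]
    by (subst nn_integral_add) (auto simp: nn_integral_cmult cong: measurable_cong_sets)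
  also have "ennreal (1 - q) * (\<integral>\<^sup>+x. kernel_op Q g x \<partial>stationary) =
             (\<Sum>n. ennreal ((1 - q) ^ Suc n * q) * (kernel_op Q ^^ Suc n) g z)"
    unfolding nn_integral_stationary[OF Qg] ennreal_suminf_cmult[symmetric] mult.assoc[symmetric]
    using q by (simp add: ennreal_mult[symmetric] funpow_swap1 ac_simps)
  \<comment> \<open>Here \<open>q * g z\<close> is the term of index 0 that the shifted series
    misses.\<close>
  also have "ennreal q * g z + \<dots> = (\<Sum>n. ennreal ((1 - q) ^ n * q) * (kernel_op Q ^^ n) g z)"
  proof -
    let ?h = "\<lambda>n. ennreal ((1 - q) ^ n * q) * (kernel_op Q ^^ n) g z"
    have "(\<lambda>n. ?h (Suc n)) sums (\<Sum>n. ?h (Suc n))"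
      by (rule summable_sums) simp
    from sums_Suc[OF this] show ?thesis
      by (simp add: sums_iff add.commute)
  qed
  finally show ?thesis
    by (simp add: nn_integral_stationary[OF g])
qed

lemma nn_integral_kernel_op_pow_stationary:
  assumes g: "g \<in> borel_measurable X"
  shows "(\<integral>\<^sup>+x. (kernel_op K ^^ n) g x \<partial>stationary) = (\<integral>\<^sup>+x. g x \<partial>stationary)"
  by (induction n) (simp_all add: nn_integral_kernel_op_stationary measurable_kernel_op_pow[OF K g])

lemma invariant_probability_stationary: "invariant_probability X K stationary"
proof -
  note st = stationary_in_prob_algebra
  then have sp: "prob_space stationary" "sets stationary = sets X"
    by (auto simp: space_prob_algebra)
  have "bind stationary K = stationary"
  proof (rule measure_eqI)
    show *: "sets (bind stationary K) = sets stationary"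
      by (simp add: sp(2) sets_bind'[OF st markov_kernelD(1)[OF K]])
    fix A assume "A \<in> sets (bind stationary K)"
    then have [measurable]: "A \<in> sets X" and A: "A \<in> sets stationary"
      by (simp_all add: * sp(2))
    have "emeasure (bind stationary K) A = (\<integral>\<^sup>+x. emeasure (K x) A \<partial>stationary)"
      by (rule emeasure_bind_prob_algebra[OF st markov_kernelD(1)[OF K]]) simp
    also have "\<dots> = (\<integral>\<^sup>+x. kernel_op K (indicator A) x \<partial>stationary)"
      by (intro nn_integral_cong)
         (simp add: kernel_op_def markov_kernelD(4)[OF K] sets_eq_imp_space_eq[OF sp(2)])
    also have "\<dots> = emeasure stationary A"
      using A by (subst nn_integral_kernel_op_stationary) simp_all
    finally show "emeasure (bind stationary K) A = emeasure stationary A" .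
  qed
  with sp show ?thesis
    by (simp add: invariant_probability_def)
qed

text \<open>Of the two branches of \<open>K\<close>, only the one along \<open>Q\<close> is kept at
  each of the \<open>n\<close> steps.\<close>

lemma kernel_op_pow_le:
  assumes g: "g \<in> borel_measurable X" and x: "x \<in> space X"
  shows "ennreal ((1 - q) ^ n) * (kernel_op Q ^^ n) g x \<le> (kernel_op K ^^ n) g x"
  using x
proof (induction n arbitrary: x)
  case (Suc n)
  let ?Q = "(kernel_op Q ^^ n) g" and ?K = "(kernel_op K ^^ n) g"
  have Qg: "?Q \<in> borel_measurable X" and Kg: "?K \<in> borel_measurable X"
    by (rule measurable_kernel_op_pow[OF Q g], rule measurable_kernel_op_pow[OF K g])
  have "ennreal ((1 - q) ^ Suc n) * kernel_op Q ?Q x =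
        ennreal (1 - q) * (\<integral>\<^sup>+y. ennreal ((1 - q) ^ n) * ?Q y \<partial>Q x)"
    using q Qg markov_kernelD(4)[OF Q Suc.prems] unfolding kernel_op_def
    by (subst nn_integral_cmult) (auto simp: ennreal_mult mult.assoc cong: measurable_cong_sets)
  also have "\<dots> \<le> ennreal (1 - q) * (\<integral>\<^sup>+y. ?K y \<partial>Q x)"
    using markov_kernelD(5)[OF Q Suc.prems]
    by (intro mult_left_mono nn_integral_mono Suc.IH) auto
  also have "\<dots> \<le> kernel_op K ?K x"
    unfolding kernel_op_def mixture[OF Kg Suc.prems] by simp
  finally show ?case by simp
qed simp

section \<open>Sets charged by the invariant law and sets visited by the chain\<close>

lemma emeasure_stationary:
  assumes "A \<in> sets X"
  shows "emeasure stationary A = (\<Sum>n. ennreal ((1 - q) ^ n * q) * (kernel_op Q ^^ n) (indicator A) z)"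
proof -
  have "A \<in> sets stationary"
    using assms stationary_in_prob_algebra by (simp add: space_prob_algebra)
  then show ?thesis
    using nn_integral_stationary[of "indicator A"] assms by simp
qed

lemma path_law_infinitely_often_of_stationary_pos:
  assumes A: "A \<in> sets X" and pos: "0 < emeasure stationary A" and x: "x \<in> space X" and q1: "q < 1"
  shows "measure (path_law X K x) {\<omega> \<in> space (path_law X K x). infinite {n. \<omega> n \<in> A}} = 1"
proof -
  have ind: "indicator A \<in> borel_measurable X"
    using A by simp
  have "\<exists>n. (kernel_op Q ^^ n) (indicator A) z \<noteq> 0"
  proof (rule ccontr)
    assume "\<not> ?thesis"
    then have "emeasure stationary A = 0"
      by (simp add: emeasure_stationary[OF A])
    with pos show False by simp
  qed
  then obtain n where n: "(kernel_op Q ^^ n) (indicator A) z \<noteq> 0" by blast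
  let ?E = "excursion n"
  have E: "?E \<in> space (prob_algebra X)"
    by (rule excursion_in_prob_algebra)
  then have eE: "emeasure ?E A = ennreal (measure ?E A)"
    by (simp add: space_prob_algebra prob_space_def finite_measure.emeasure_eq_measure)
  have eq: "(kernel_op Q ^^ n) (indicator A) z = emeasure ?E A"
    using nn_integral_excursion[OF ind, of n] A E by (simp add: space_prob_algebra)
  have pE: "0 < measure ?E A"
    using n unfolding eq eE ennreal_eq_0_iff not_le .
  \<comment> \<open>The factors are the chances of jumping to \<open>z\<close>, of then taking
    \<open>n\<close> steps without a forced jump, and of those steps ending in \<open>A\<close>.
    None depends on the starting state, and \<open>q < 1\<close> keeps the middle one
    positive.\<close>
  define e where "e = q * ((1 - q) ^ n * measure ?E A)"
  show ?thesis
  proof (rule path_law_infinitely_often[OF K x A, where k = "Suc n" and e = e])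
    show "0 < e"
      unfolding e_def using q q1 pE by (intro mult_pos_pos zero_less_power) simp_all
    fix y assume y: "y \<in> space X"
    have Kn: "(kernel_op K ^^ n) (indicator A) \<in> borel_measurable X"
      by (rule measurable_kernel_op_pow[OF K ind])
    have "ennreal e = ennreal q * (ennreal ((1 - q) ^ n) * (kernel_op Q ^^ n) (indicator A) z)"
      unfolding e_def eq eE using q by (simp only: ennreal_mult zero_le_power mult_nonneg_nonneg
          measure_nonneg less_imp_le diff_ge_0_iff_ge)
    also have "\<dots> \<le> ennreal q * (kernel_op K ^^ n) (indicator A) z"
      by (intro mult_left_mono kernel_op_pow_le ind z) simp
    \<comment> \<open>For the first step from \<open>y\<close>, the branch along \<open>Q\<close> is
      discarded.\<close>
    also have "\<dots> \<le> (kernel_op K ^^ Suc n) (indicator A) y"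
      unfolding funpow.simps comp_apply kernel_op_def[of K "(kernel_op K ^^ n) (indicator A)"] mixture[OF Kn y]
      by (rule add_increasing2) simp_all
    finally show "ennreal e \<le> (kernel_op K ^^ Suc n) (indicator A) y" .
  qed
qed

text \<open>The input for maximality. If the invariant law gives \<open>A\<close> mass 0, then by
  invariance it integrates every \<open>n\<close>-step probability of \<open>A\<close> to 0. Since
  it charges \<open>z\<close>, these probabilities vanish at \<open>z\<close>, and a countable union
  over the times finishes.\<close>

lemma stationary_pos_of_path_law_pos:
  assumes A: "A \<in> sets X"
    and pos: "0 < measure (path_law X K z) {\<omega> \<in> space (path_law X K z). \<exists>n\<ge>1. \<omega> n \<in> A}"
  shows "0 < emeasure stationary A"
proof (rule ccontr)
  assume "\<not> ?thesis"
  then have null: "emeasure stationary A = 0"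
    by simp
  note sets_path_law[OF K z, measurable_cong]
  have [measurable]: "A \<in> sets X" by fact
  let ?P = "path_law X K z" and ?g = "\<lambda>n. (kernel_op K ^^ n) (indicator A)"
  have ind: "indicator A \<in> borel_measurable X"
    using A by simp
  have "A \<in> sets stationary"
    using A stationary_in_prob_algebra by (simp add: space_prob_algebra)
  have "?g n z = 0" for n
  proof -
    \<comment> \<open>The left side is the term of index 0 in the series for the integral.\<close>
    have "ennreal q * ?g n z \<le> (\<integral>\<^sup>+x. ?g n x \<partial>stationary)"
      unfolding nn_integral_stationary[OF measurable_kernel_op_pow[OF K ind]]
      using sum_le_suminf[of "\<lambda>m. ennreal ((1 - q) ^ m * q) * (kernel_op Q ^^ m) (?g n) z" "{0}"]
      by simp
    also have "\<dots> = 0"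
      using null \<open>A \<in> sets stationary\<close> by (simp add: nn_integral_kernel_op_pow_stationary[OF ind])
    finally show ?thesis
      using q by simp
  qed
  then have "emeasure ?P {\<omega> \<in> space ?P. \<omega> n \<in> A} = 0" for n
    by (simp add: emeasure_path_law_at[OF K z A])
  moreover have "{\<omega> \<in> space ?P. \<omega> n \<in> A} \<in> sets ?P" for n
    by measurable
  ultimately have "AE \<omega> in ?P. \<omega> n \<notin> A" for n
    by (intro AE_I[where N = "{\<omega> \<in> space ?P. \<omega> n \<in> A}"]) auto
  then have "AE \<omega> in ?P. \<not> (\<exists>n\<ge>1. \<omega> n \<in> A)"
    by (auto simp: AE_all_countable)
  moreover have "{\<omega> \<in> space ?P. \<exists>n\<ge>1. \<omega> n \<in> A} \<in> sets ?P"
    by measurable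
  ultimately have "emeasure ?P {\<omega> \<in> space ?P. \<exists>n\<ge>1. \<omega> n \<in> A} = 0"
    by (subst AE_iff_measurable[symmetric]) auto
  with pos show False
    by (simp add: measure_def)
qed

text \<open>Irreducibility is read off from the infinitely many visits. For maximality, a set
  charged by any irreducibility measure is reached from \<open>z\<close>, hence charged by
  \<open>stationary\<close>.\<close>

lemma maximal_irreducibility_measure_stationary:
  assumes q1: "q < 1"
  shows "maximal_irreducibility_measure X K stationary"
proof -
  have sp: "prob_space stationary" "sets stationary = sets X" "space stationary = space X"
    using stationary_in_prob_algebra by (auto simp: space_prob_algebra dest: sets_eq_imp_space_eq)
  have "irreducibility_measure X K stationary"
    unfolding irreducibility_measure_def
  proof (intro conjI ballI impI)
    show "sets stationary = sets X" by fact
    show "sigma_finite_measure stationary"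
      using sp(1) by (simp add: prob_space_imp_sigma_finite)
    show "emeasure stationary (space X) \<noteq> 0"
      using prob_space.emeasure_space_1[OF sp(1)] sp(3) by simp
    fix A x assume A: "A \<in> sets X" "0 < emeasure stationary A" and x: "x \<in> space X"
    let ?P = "path_law X K x"
    interpret prob_space ?P
      by (rule prob_space_path_law[OF K x])
    note sets_path_law[OF K x, measurable_cong]
    have [measurable]: "A \<in> sets X" by fact
    have "1 = prob {\<omega> \<in> space ?P. infinite {n. \<omega> n \<in> A}}"
      using path_law_infinitely_often_of_stationary_pos[OF A x q1] by simp
    also have "\<dots> \<le> prob {\<omega> \<in> space ?P. \<exists>n\<ge>1. \<omega> n \<in> A}"
      proof (rule finite_measure_mono)
      show "{\<omega> \<in> space ?P. infinite {n. \<omega> n \<in> A}} \<subseteq> {\<omega> \<in> space ?P. \<exists>n\<ge>1. \<omega> n \<in> A}"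
        by (auto simp: infinite_nat_iff_unbounded_le)
    qed measurable
    finally show "0 < prob {\<omega> \<in> space ?P. \<exists>n\<ge>1. \<omega> n \<in> A}"
      by simp
  qed
  moreover have "absolutely_continuous stationary \<phi>" if \<phi>: "irreducibility_measure X K \<phi>" for \<phi>
    unfolding absolutely_continuous_def
  proof
    fix A assume "A \<in> null_sets stationary"
    then have A: "A \<in> sets X" "emeasure stationary A = 0"
      by (auto simp: sp)
    have "emeasure \<phi> A = 0"
    proof (rule ccontr)
      assume "emeasure \<phi> A \<noteq> 0"
      then have "0 < measure (path_law X K z) {\<omega> \<in> space (path_law X K z). \<exists>n\<ge>1. \<omega> n \<in> A}"
        using \<phi> A(1) z by (auto simp: irreducibility_measure_def zero_less_iff_neq_zero)
      from stationary_pos_of_path_law_pos[OF A(1) this] A(2) show False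
        by simp
    qed
    with A(1) \<phi> show "A \<in> null_sets \<phi>"
      by (auto simp: irreducibility_measure_def)
  qed
  ultimately show ?thesis
    by (simp add: maximal_irreducibility_measure_def)
qed

text \<open>Every one-step law charges \<open>z\<close>, so \<open>z\<close> lies in every class of a cycle.\<close>

lemma cycle_length_1:
  assumes "cycle X K \<psi> d D" and \<psi>: "emeasure \<psi> (space X) \<noteq> 0"
  shows "d = 1"
proof -
  have d: "d \<ge> 1" and D: "\<And>i. i < d \<Longrightarrow> D i \<in> sets X" and disj: "disjoint_family_on D {..<d}"
    and step: "\<And>i x. i < d \<Longrightarrow> x \<in> D i \<Longrightarrow> measure (K x) (D (Suc i mod d)) = 1"
    and null: "emeasure \<psi> (space X - (\<Union>i<d. D i)) = 0"
    using assms(1) by (auto simp: cycle_def)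
  \<comment> \<open>If \<open>z\<close> were outside the class following that of \<open>x\<close>,
    the law \<open>K x\<close> would put mass at least \<open>q\<close> outside it.\<close>
  have z_next: "z \<in> D (Suc i mod d)" if i: "i < d" and x: "x \<in> D i" for i x
  proof (rule ccontr)
    let ?C = "space X - D (Suc i mod d)"
    assume "z \<notin> D (Suc i mod d)"
    with z have zC: "z \<in> ?C" by simp
    have Dn: "D (Suc i mod d) \<in> sets X"
      using d by (intro D) simp
    have xX: "x \<in> space X"
      using D[OF i] x sets.sets_into_space by blast
    interpret prob_space "K x"
      by (rule markov_kernelD(3)[OF K xX])
    have "prob ?C = 0"
      using prob_compl[of "D (Suc i mod d)"] step[OF i x] Dn
      by (simp add: markov_kernelD(4,5)[OF K xX])
    then have "(\<integral>\<^sup>+y. indicator ?C y \<partial>K x) = 0"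
      using Dn by (simp add: emeasure_eq_measure markov_kernelD(4)[OF K xX])
    moreover have "(\<integral>\<^sup>+y. indicator ?C y \<partial>K x) \<ge> ennreal q * indicator ?C z"
      using Dn by (subst mixture[OF _ xX]) auto
    ultimately show False
      using zC q by simp
  qed
  \<comment> \<open>Some class has a point, since otherwise the whole space would be null for
    \<open>\<psi>\<close>.\<close>
  have "(\<Union>i<d. D i) \<noteq> {}"
  proof
    assume "(\<Union>i<d. D i) = {}"
    with null \<psi> show False by (simp only: Diff_empty)
  qed
  then obtain i0 x0 where i0: "i0 < d" "x0 \<in> D i0"
    by blast
  \<comment> \<open>The class after that of \<open>x0\<close> contains \<open>z\<close>, and so does
    its successor. Disjointness makes the two indices equal, which forces length 1.\<close>
  define i where "i = Suc i0 mod d"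
  have i: "i < d" "z \<in> D i"
    using d z_next[OF i0] by (simp_all add: i_def)
  have "z \<in> D (Suc i mod d)"
    by (rule z_next[OF i])
  moreover have "Suc i mod d < d"
    using d by simp
  ultimately have eq: "Suc i mod d = i"
    using disj i unfolding disjoint_family_on_def by blast
  show ?thesis
  proof (cases "Suc i < d")
    case True with eq show ?thesis by simp
  next
    case False
    with i have "Suc i = d" by simp
    with eq show ?thesis by auto
  qed
qed

lemma harris_ergodic_mixture:
  assumes q1: "q < 1"
  shows "harris_ergodic X K"
proof -
  note max = maximal_irreducibility_measure_stationary[OF q1]
  then have "emeasure stationary (space X) \<noteq> 0"
    by (simp add: maximal_irreducibility_measure_def irreducibility_measure_def)
  then have "aperiodic X K"
    using max cycle_length_1 unfolding aperiodic_def by blast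
  moreover have "harris_recurrent X K"
    using max path_law_infinitely_often_of_stationary_pos[OF _ _ _ q1]
    unfolding harris_recurrent_def by blast
  ultimately show ?thesis
    using K invariant_probability_stationary
    by (auto simp: harris_ergodic_def positive_harris_recurrent_def)
qed

end

section \<open>Measurability of the queue step\<close>

lemma sorted_nth_le_iff:
  fixes xs :: "'a::linorder list"
  assumes "sorted xs" "i < length xs"
  shows "xs ! i \<le> a \<longleftrightarrow> i < length (filter (\<lambda>x. x \<le> a) xs)"
  using assms
proof (induction xs arbitrary: i)
  case (Cons x xs)
  show ?case
  proof (cases "x \<le> a")
    case True
    with Cons show ?thesis by (cases i) auto
  next
    case False
    with Cons.prems have "\<forall>y\<in>set (x # xs). \<not> y \<le> a"
      by auto
    then have "filter (\<lambda>x. x \<le> a) (x # xs) = []" "\<not> (x # xs) ! i \<le> a"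
      using nth_mem[OF Cons.prems(2)] by (simp_all only: filter_empty_conv) blast+
    then show ?thesis by simp
  qed
qed simp

text \<open>In a sorted list the entries at most \<open>a\<close> form an initial segment, and their
  number does not change under sorting.\<close>

lemma sort_nth_le_iff:
  fixes xs :: "'a::linorder list"
  assumes "i < length xs"
  shows "sort xs ! i \<le> a \<longleftrightarrow> i < length (filter (\<lambda>x. x \<le> a) xs)"
proof -
  have "length (filter (\<lambda>x. x \<le> a) (sort xs)) = length (filter (\<lambda>x. x \<le> a) xs)"
    by (metis mset_filter mset_sort size_mset)
  with assms show ?thesis
    by (simp add: sorted_nth_le_iff)
qed

lemma length_filter_map_upt:
  "length (filter P (map y [0..<r])) = (\<Sum>j<r. if P (y j) then 1 else 0)"
  by (induction r) auto

text \<open>The sublevel sets of an order statistic say how many of the functions are at most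
  \<open>a\<close>, so the sorting disappears from the measurability question.\<close>

lemma borel_measurable_sort_nth:
  fixes f :: "nat \<Rightarrow> 'a \<Rightarrow> real"
  assumes [measurable]: "\<And>j. j < r \<Longrightarrow> f j \<in> borel_measurable M" and i: "i < r"
  shows "(\<lambda>w. sort (map (\<lambda>j. f j w) [0..<r]) ! i) \<in> borel_measurable M"
  unfolding borel_measurable_iff_le
proof
  fix a
  have "Measurable.pred M (\<lambda>w. i < (\<Sum>j<r. if f j w \<le> a then 1 else 0 :: nat))"
    by measurable
  moreover have "sort (map (\<lambda>j. f j w) [0..<r]) ! i \<le> a \<longleftrightarrow>
      i < (\<Sum>j<r. if f j w \<le> a then 1 else 0)" for w
    using i sort_nth_le_iff[of i "map (\<lambda>j. f j w) [0..<r]" a]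
    unfolding length_filter_map_upt by simp
  ultimately show "{w \<in> space M. sort (map (\<lambda>j. f j w) [0..<r]) ! i \<le> a} \<in> sets M"
    by (simp add: pred_def)
qed

section \<open>The ordered state space and the kernels on it\<close>

lemma space_workload_space:
  "space (workload_space r) =
     {x \<in> extensional {..<r}. (\<forall>i<r. 0 \<le> x i) \<and> (\<forall>i j. i \<le> j \<and> j < r \<longrightarrow> x i \<le> x j)}"
  by (auto simp: workload_space_def space_restrict_space space_PiM PiE_def)

lemma zero_vec_in_workload_space: "zero_vec r \<in> space (workload_space r)"
  by (auto simp: space_workload_space zero_vec_def)

text \<open>Sorting creates the order, which the common shift and the truncation preserve; the
  truncation gives the signs.\<close>

lemma queue_step_in_workload_space: "queue_step r u v x \<in> space (workload_space r)"
  by (auto simp: space_workload_space queue_step_def rearrange_def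
           intro!: max.coboundedI2 diff_right_mono sorted_nth_mono)

text \<open>All three arguments may vary over an arbitrary space, so that the same statement serves
  the kernel, where the state is frozen, and the recursion, where it is random.\<close>

lemma measurable_queue_step:
  assumes "r > 0"
    and [measurable]: "u \<in> borel_measurable M" "v \<in> borel_measurable M" "x \<in> M \<rightarrow>\<^sub>M workload_space r"
  shows "(\<lambda>w. queue_step r (u w) (v w) (x w)) \<in> M \<rightarrow>\<^sub>M workload_space r"
proof -
  have x: "x \<in> M \<rightarrow>\<^sub>M PiM {..<r} (\<lambda>_. borel)"
    using assms(4) unfolding workload_space_def by (simp add: measurable_restrict_space2_iff)
  have xj [measurable]: "(\<lambda>w. x w j) \<in> borel_measurable M" if "j < r" for j
    by (rule measurable_compose[OF x measurable_component_singleton]) (use that in simp)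
  have x0 [measurable]: "(\<lambda>w. x w 0) \<in> borel_measurable M"
    using \<open>r > 0\<close> by (rule xj)
  have upd [measurable]: "(\<lambda>w. ((x w)(0 := x w 0 + v w)) j) \<in> borel_measurable M" if "j < r" for j
    using xj[OF that] by (cases "j = 0") simp_all
  have [measurable]: "(\<lambda>w. sort (map ((x w)(0 := x w 0 + v w)) [0..<r]) ! i) \<in> borel_measurable M"
    if "i < r" for i
    using that upd by (rule borel_measurable_sort_nth[rotated])
  have "(\<lambda>w. queue_step r (u w) (v w) (x w)) \<in> M \<rightarrow>\<^sub>M PiM {..<r} (\<lambda>_. borel)"
    unfolding queue_step_def rearrange_def
    by (rule measurable_restrict) (simp cong: measurable_cong)
  moreover have "queue_step r (u w) (v w) (x w) \<in>
      {x. (\<forall>i<r. 0 \<le> x i) \<and> (\<forall>i j. i \<le> j \<and> j < r \<longrightarrow> x i \<le> x j)}" for w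
    using queue_step_in_workload_space[of r "u w" "v w" "x w"] by (auto simp: space_workload_space)
  ultimately show ?thesis
    unfolding workload_space_def by (intro measurable_restrict_space2) auto
qed

text \<open>The queue without clearing, isolated to play the part of \<open>Q\<close>.\<close>

definition queue_kernel :: "nat \<Rightarrow> (real \<times> real) measure \<Rightarrow> (nat \<Rightarrow> real) \<Rightarrow> (nat \<Rightarrow> real) measure" where
  "queue_kernel r D x = distr D (workload_space r) (\<lambda>(u, v). queue_step r u v x)"

lemma markov_kernel_queue_kernel:
  assumes "r > 0" and D: "prob_space D" "sets D = sets (borel \<Otimes>\<^sub>M borel)"
  shows "markov_kernel (workload_space r) (queue_kernel r D)"
  unfolding markov_kernel_def queue_kernel_def
proof (rule measurable_distr_prob_space2[where M = "borel \<Otimes>\<^sub>M borel"])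
  show "(\<lambda>x. D) \<in> workload_space r \<rightarrow>\<^sub>M prob_algebra (borel \<Otimes>\<^sub>M borel)"
    using D by (simp add: space_prob_algebra)
  show "(\<lambda>(x, p). case p of (u, v) \<Rightarrow> queue_step r u v x) \<in>
      workload_space r \<Otimes>\<^sub>M (borel \<Otimes>\<^sub>M borel) \<rightarrow>\<^sub>M workload_space r"
    unfolding split_beta by (rule measurable_queue_step[OF \<open>r > 0\<close>]) measurable
qed

lemma markov_kernel_clearing_kernel:
  assumes r: "r > 0" and D: "prob_space D" "sets D = sets (borel \<Otimes>\<^sub>M borel)"
  shows "markov_kernel (workload_space r) (clearing_kernel r q D)"
  unfolding markov_kernel_def clearing_kernel_def queue_kernel_def[symmetric]
proof (rule measurable_bind_prob_space2[where N = "count_space UNIV"])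
  show "(\<lambda>x. measure_pmf (bernoulli_pmf q)) \<in> workload_space r \<rightarrow>\<^sub>M prob_algebra (count_space UNIV)"
    by (simp add: space_prob_algebra prob_space_measure_pmf)
  have [measurable]: "queue_kernel r D \<in> workload_space r \<rightarrow>\<^sub>M prob_algebra (workload_space r)"
    using markov_kernel_queue_kernel[OF r D] by (simp add: markov_kernel_def)
  have [measurable]: "return (workload_space r) (zero_vec r) \<in> space (prob_algebra (workload_space r))"
    by (simp add: space_prob_algebra prob_space_return zero_vec_in_workload_space)
  show "(\<lambda>(x, clear). if clear then return (workload_space r) (zero_vec r) else queue_kernel r D x) \<in>
      workload_space r \<Otimes>\<^sub>M count_space UNIV \<rightarrow>\<^sub>M prob_algebra (workload_space r)"
    by measurable
qed

text \<open>Supplies \<open>mixture\<close> for the queue, with atom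
  \<open>zero_vec r\<close>.\<close>

lemma nn_integral_clearing_kernel:
  assumes r: "r > 0" and D: "prob_space D" "sets D = sets (borel \<Otimes>\<^sub>M borel)"
    and q: "0 \<le> q" "q \<le> 1"
    and g: "g \<in> borel_measurable (workload_space r)" and x: "x \<in> space (workload_space r)"
  shows "(\<integral>\<^sup>+y. g y \<partial>clearing_kernel r q D x) =
    ennreal q * g (zero_vec r) + ennreal (1 - q) * (\<integral>\<^sup>+y. g y \<partial>queue_kernel r D x)"
proof -
  let ?X = "workload_space r"
  have "(\<lambda>clear. if clear then return ?X (zero_vec r) else queue_kernel r D x)
      \<in> measure_pmf (bernoulli_pmf q) \<rightarrow>\<^sub>M subprob_algebra ?X"
    using measurable_space[OF markov_kernelD(2)[OF markov_kernel_queue_kernel[OF r D]] x]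
      measurable_space[OF return_measurable zero_vec_in_workload_space[of r]]
    by simp
  then show ?thesis
    unfolding clearing_kernel_def queue_kernel_def[symmetric] using q
    by (simp add: nn_integral_bind[OF g] nn_integral_return[OF zero_vec_in_workload_space g] mult.commute)
qed

section \<open>Chains driven by independent innovations\<close>

lemma distr_indep_pair:
  assumes "prob_space M" and ind: "indep_pair M N\<^sub>1 X N\<^sub>2 Y"
  shows "distr M (N\<^sub>1 \<Otimes>\<^sub>M N\<^sub>2) (\<lambda>\<omega>. (X \<omega>, Y \<omega>)) = distr M N\<^sub>1 X \<Otimes>\<^sub>M distr M N\<^sub>2 Y"
proof -
  interpret prob_space M by fact
  have [measurable]: "X \<in> M \<rightarrow>\<^sub>M N\<^sub>1" "Y \<in> M \<rightarrow>\<^sub>M N\<^sub>2"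
    and indep: "indep_set {X -` A \<inter> space M |A. A \<in> sets N\<^sub>1} {Y -` B \<inter> space M |B. B \<in> sets N\<^sub>2}"
    using ind by (auto simp: indep_pair_def)
  have "distr M N\<^sub>1 X \<Otimes>\<^sub>M distr M N\<^sub>2 Y = distr M (N\<^sub>1 \<Otimes>\<^sub>M N\<^sub>2) (\<lambda>\<omega>. (X \<omega>, Y \<omega>))"
  proof (rule pair_measure_eqI)
    show "sigma_finite_measure (distr M N\<^sub>1 X)" "sigma_finite_measure (distr M N\<^sub>2 Y)"
      by (simp_all add: prob_space_distr prob_space_imp_sigma_finite)
    fix A B assume "A \<in> sets (distr M N\<^sub>1 X)" "B \<in> sets (distr M N\<^sub>2 Y)"
    then have [measurable]: "A \<in> sets N\<^sub>1" "B \<in> sets N\<^sub>2"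
      by simp_all
    have "(\<lambda>\<omega>. (X \<omega>, Y \<omega>)) -` (A \<times> B) \<inter> space M = (X -` A \<inter> space M) \<inter> (Y -` B \<inter> space M)"
      by auto
    moreover have "prob ((X -` A \<inter> space M) \<inter> (Y -` B \<inter> space M)) =
        prob (X -` A \<inter> space M) * prob (Y -` B \<inter> space M)"
      by (rule indep_setD[OF indep]) auto
    ultimately show "emeasure (distr M N\<^sub>1 X) A * emeasure (distr M N\<^sub>2 Y) B =
        emeasure (distr M (N\<^sub>1 \<Otimes>\<^sub>M N\<^sub>2) (\<lambda>\<omega>. (X \<omega>, Y \<omega>))) (A \<times> B)"
      by (simp add: emeasure_distr emeasure_eq_measure ennreal_mult)
  qed simp
  then show ?thesis ..
qed

text \<open>Fubini for the product law; the inner integral treats \<open>Y\<close> as an independent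
  copy, with \<open>X\<close> frozen.\<close>

lemma nn_integral_indep_pair:
  assumes M: "prob_space M" and ind: "indep_pair M N\<^sub>1 X N\<^sub>2 Y"
    and f: "f \<in> borel_measurable (N\<^sub>1 \<Otimes>\<^sub>M N\<^sub>2)"
  shows "(\<integral>\<^sup>+\<omega>. f (X \<omega>, Y \<omega>) \<partial>M) = (\<integral>\<^sup>+\<omega>. (\<integral>\<^sup>+\<omega>'. f (X \<omega>, Y \<omega>') \<partial>M) \<partial>M)"
proof -
  interpret prob_space M by fact
  have [measurable]: "X \<in> M \<rightarrow>\<^sub>M N\<^sub>1" "Y \<in> M \<rightarrow>\<^sub>M N\<^sub>2"
    using ind by (auto simp: indep_pair_def)
  note f [measurable]
  interpret Y: prob_space "distr M N\<^sub>2 Y"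
    by (rule prob_space_distr) measurable
  have "(\<integral>\<^sup>+\<omega>. f (X \<omega>, Y \<omega>) \<partial>M) = (\<integral>\<^sup>+p. f p \<partial>distr M (N\<^sub>1 \<Otimes>\<^sub>M N\<^sub>2) (\<lambda>\<omega>. (X \<omega>, Y \<omega>)))"
    by (simp add: nn_integral_distr)
  also have "\<dots> = (\<integral>\<^sup>+x. (\<integral>\<^sup>+y. f (x, y) \<partial>distr M N\<^sub>2 Y) \<partial>distr M N\<^sub>1 X)"
    unfolding distr_indep_pair[OF M ind]
    by (rule Y.nn_integral_fst[symmetric]) (simp cong: measurable_cong_sets)
  also have "\<dots> = (\<integral>\<^sup>+x. (\<integral>\<^sup>+\<omega>'. f (x, Y \<omega>') \<partial>M) \<partial>distr M N\<^sub>1 X)"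
    by (intro nn_integral_cong) (simp add: nn_integral_distr)
  also have "\<dots> = (\<integral>\<^sup>+\<omega>. (\<integral>\<^sup>+\<omega>'. f (X \<omega>, Y \<omega>') \<partial>M) \<partial>M)"
    by (subst nn_integral_distr) simp_all
  finally show ?thesis .
qed

text \<open>Needed where independence passes from generators to the \<sigma>-algebras of blocks of
  sources.\<close>

lemma Int_stable_preimages:
  assumes "f \<in> M \<rightarrow>\<^sub>M N"
  shows "Int_stable {f -` A \<inter> space M |A. A \<in> sets N}"
proof -
  have "f \<in> space M \<rightarrow> space N"
    using measurable_space[OF assms] by blast
  from sets_vimage_algebra2[OF this] show ?thesis
    using sets.Int_stable[of "vimage_algebra (space M) f N"] by simp
qed

text \<open>\<open>None\<close> indexes the events of the initial value, \<open>Some n\<close> those of the \<open>n\<close>th innovation.\<close>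

definition source_events ::
  "'a measure \<Rightarrow> 's measure \<Rightarrow> 'z measure \<Rightarrow> ('a \<Rightarrow> 's) \<Rightarrow> (nat \<Rightarrow> 'a \<Rightarrow> 'z) \<Rightarrow> nat option \<Rightarrow> 'a set set" where
  "source_events M X N W\<^sub>0 Z i = (case i of
     None \<Rightarrow> {W\<^sub>0 -` A \<inter> space M |A. A \<in> sets X}
   | Some n \<Rightarrow> {Z n -` C \<inter> space M |C. C \<in> sets N})"

definition past ::
  "'a measure \<Rightarrow> 's measure \<Rightarrow> 'z measure \<Rightarrow> ('a \<Rightarrow> 's) \<Rightarrow> (nat \<Rightarrow> 'a \<Rightarrow> 'z) \<Rightarrow> nat \<Rightarrow> 'a measure" where
  "past M X N W\<^sub>0 Z n =
     sigma (space M) (\<Union>i\<in>insert None (Some ` {..<n}). source_events M X N W\<^sub>0 Z i)"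

section \<open>Joint independence of the initial value and the innovations\<close>

context prob_space
begin

context
  fixes X :: "'s measure" and N :: "'z measure" and W\<^sub>0 :: "'a \<Rightarrow> 's" and Z :: "nat \<Rightarrow> 'a \<Rightarrow> 'z"
  assumes indep_Z: "indep_vars (\<lambda>_. N) Z UNIV"
    and indep_init: "indep_pair M X W\<^sub>0 (PiM UNIV (\<lambda>_. N)) (\<lambda>\<omega> n. Z n \<omega>)"
begin

lemma source_measurable: "W\<^sub>0 \<in> M \<rightarrow>\<^sub>M X" "Z n \<in> M \<rightarrow>\<^sub>M N"
  using indep_init indep_Z by (auto simp: indep_pair_def indep_vars_def2)

lemma source_events_subset: "source_events M X N W\<^sub>0 Z i \<subseteq> events"
  using source_measurable by (auto simp: source_events_def split: option.split)

text \<open>Two hypotheses are merged: the innovations are independent of each other, and the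
  initial value is independent of their whole sequence.\<close>

lemma indep_source_events: "indep_sets (source_events M X N W\<^sub>0 Z) UNIV"
proof (rule indep_setsI)
  fix A and J :: "nat option set"
  assume J: "finite J" "J \<noteq> {}" and A: "\<forall>j\<in>J. A j \<in> source_events M X N W\<^sub>0 Z j"
  define I where "I = {i. Some i \<in> J}"
  have I: "finite I"
    unfolding I_def using finite_vimageI[OF J(1) inj_Some] by (simp add: vimage_def)
  have AI: "\<exists>C. A (Some i) = Z i -` C \<inter> space M \<and> C \<in> sets N" if "i \<in> I" for i
    using that A by (auto simp: I_def source_events_def)
  have prod: "prob (\<Inter>i\<in>I. A (Some i)) = (\<Prod>i\<in>I. prob (A (Some i)))" if "I \<noteq> {}"
  proof (rule indep_setsD)
    show "indep_sets (\<lambda>i. {Z i -` C \<inter> space M |C. C \<in> sets N}) UNIV"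
      using indep_Z by (simp add: indep_vars_def2)
  qed (use I AI that in auto)
  show "prob (\<Inter>j\<in>J. A j) = (\<Prod>j\<in>J. prob (A j))"
  proof (cases "None \<in> J")
    case False
    then have JI: "J = Some ` I"
      by (auto simp: I_def image_iff) (metis not_None_eq)
    with J(2) prod show ?thesis
      by (simp add: prod.reindex)
  next
    case True
    then have JI: "J = insert None (Some ` I)"
      by (auto simp: I_def image_iff) (metis not_None_eq)
    show ?thesis
    proof (cases "I = {}")
      case True
      then show ?thesis by (simp add: JI)
    next
      case False
      obtain C where C: "\<And>i. i \<in> I \<Longrightarrow> A (Some i) = Z i -` C i \<inter> space M" "\<And>i. i \<in> I \<Longrightarrow> C i \<in> sets N"
        using AI by metis
      \<comment> \<open>Finitely many innovation events combine into one cylinder event of the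
        sequence, to which \<open>indep_init\<close> applies.\<close>
      let ?C = "{f \<in> space (PiM UNIV (\<lambda>_. N)). \<forall>i\<in>I. f i \<in> C i}"
      have C': "?C \<in> sets (PiM UNIV (\<lambda>_. N))"
        using I C(2) by measurable
      have "(\<Inter>i\<in>I. A (Some i)) = (\<lambda>\<omega> n. Z n \<omega>) -` ?C \<inter> space M"
        using False C(1) measurable_space[OF source_measurable(2)] by (auto simp: space_PiM)
      moreover obtain B where B: "A None = W\<^sub>0 -` B \<inter> space M" "B \<in> sets X"
        using bspec[OF A \<open>None \<in> J\<close>] by (auto simp: source_events_def)
      moreover have "prob ((W\<^sub>0 -` B \<inter> space M) \<inter> ((\<lambda>\<omega> n. Z n \<omega>) -` ?C \<inter> space M)) =
          prob (W\<^sub>0 -` B \<inter> space M) * prob ((\<lambda>\<omega> n. Z n \<omega>) -` ?C \<inter> space M)"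
        by (rule indep_setD[OF conjunct2[OF conjunct2[OF indep_init[unfolded indep_pair_def]]]])
           (use B C' in blast)+
      ultimately have "prob (A None \<inter> (\<Inter>i\<in>I. A (Some i))) = prob (A None) * prob (\<Inter>i\<in>I. A (Some i))"
        by simp
      then show ?thesis
        using I prod[OF False] by (simp add: JI prod.reindex)
    qed
  qed
qed (rule source_events_subset)

lemma past_sets: "sets (past M X N W\<^sub>0 Z n) = sigma_sets (space M) (\<Union>i\<in>insert None (Some ` {..<n}). source_events M X N W\<^sub>0 Z i)"
  and past_space: "space (past M X N W\<^sub>0 Z n) = space M"
proof -
  have "(\<Union>i\<in>insert None (Some ` {..<n}). source_events M X N W\<^sub>0 Z i) \<subseteq> Pow (space M)"
    using source_events_subset sets.sets_into_space by blast
  then show "sets (past M X N W\<^sub>0 Z n) = sigma_sets (space M) (\<Union>i\<in>insert None (Some ` {..<n}). source_events M X N W\<^sub>0 Z i)"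
    "space (past M X N W\<^sub>0 Z n) = space M"
    by (simp_all add: past_def)
qed

lemma indep_past:
  assumes B: "B \<in> sets (past M X N W\<^sub>0 Z n)" and C: "C \<in> sets N"
  shows "prob (B \<inter> (Z n -` C \<inter> space M)) = prob B * prob (Z n -` C \<inter> space M)"
proof -
  \<comment> \<open>Two disjoint blocks of sources: \<open>True\<close> selects the past,
    \<open>False\<close> the single innovation \<open>n\<close>.\<close>
  define I where "I b = (if b then insert None (Some ` {..<n}) else {Some n})" for b
  have "indep_sets (\<lambda>b. sigma_sets (space M) (\<Union>i\<in>I b. source_events M X N W\<^sub>0 Z i)) UNIV"
  proof (rule indep_sets_collect_sigma)
    show "indep_sets (source_events M X N W\<^sub>0 Z) (\<Union> (I ` UNIV))"
      by (rule indep_sets_mono_index[OF _ indep_source_events]) simp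
    show "Int_stable (source_events M X N W\<^sub>0 Z i)" for i
      using Int_stable_preimages[OF source_measurable(1)] Int_stable_preimages[OF source_measurable(2)]
      by (simp add: source_events_def split: option.split)
    show "disjoint_family_on I UNIV"
      by (auto simp: disjoint_family_on_def I_def)
  qed
  moreover have "Z n -` C \<inter> space M \<in> source_events M X N W\<^sub>0 Z (Some n)"
    using C by (auto simp: source_events_def)
  ultimately have "prob (\<Inter>b\<in>UNIV. case_bool B (Z n -` C \<inter> space M) b) =
      (\<Prod>b\<in>UNIV. prob (case_bool B (Z n -` C \<inter> space M) b))"
    using B by (intro indep_setsD) (auto simp: past_sets I_def split: bool.split)
  then show ?thesis
    by (simp add: UNIV_bool ac_simps)
qed

lemma measurable_past_0: "W\<^sub>0 \<in> past M X N W\<^sub>0 Z n \<rightarrow>\<^sub>M X"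
proof (rule measurableI)
  fix A assume "A \<in> sets X"
  then have "W\<^sub>0 -` A \<inter> space M \<in> source_events M X N W\<^sub>0 Z None"
    by (auto simp: source_events_def)
  then show "W\<^sub>0 -` A \<inter> space (past M X N W\<^sub>0 Z n) \<in> sets (past M X N W\<^sub>0 Z n)"
    unfolding past_sets past_space by (intro sigma_sets.Basic) simp
qed (use measurable_space[OF source_measurable(1)] in \<open>simp add: past_space\<close>)

lemma measurable_past_innovation: "k < n \<Longrightarrow> Z k \<in> past M X N W\<^sub>0 Z n \<rightarrow>\<^sub>M N"
proof (rule measurableI)
  fix C assume "k < n" "C \<in> sets N"
  then have "Z k -` C \<inter> space M \<in> source_events M X N W\<^sub>0 Z (Some k)"
    by (auto simp: source_events_def)
  with \<open>k < n\<close> show "Z k -` C \<inter> space (past M X N W\<^sub>0 Z n) \<in> sets (past M X N W\<^sub>0 Z n)"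
    unfolding past_sets past_space by (intro sigma_sets.Basic) auto
qed (use measurable_space[OF source_measurable(2)] in \<open>simp add: past_space\<close>)

end

text \<open>The path up to time \<open>n\<close> is a function of the past, hence independent of
  \<open>Z n\<close>. Conditioning on it therefore freezes \<open>W n\<close> in
  \<open>F (W n) (Z n)\<close>, and \<open>law\<close> identifies the resulting
  distribution.\<close>

lemma markov_chain_random_recursion:
  assumes K: "markov_kernel X K"
    and indep_Z: "indep_vars (\<lambda>_. N) Z UNIV"
    and indep_init: "indep_pair M X (W 0) (PiM UNIV (\<lambda>_. N)) (\<lambda>\<omega> n. Z n \<omega>)"
    and F: "(\<lambda>(x, z). F x z) \<in> X \<Otimes>\<^sub>M N \<rightarrow>\<^sub>M X"
    and recursion: "\<And>n \<omega>. \<omega> \<in> space M \<Longrightarrow> W (Suc n) \<omega> = F (W n \<omega>) (Z n \<omega>)"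
    and law: "\<And>n x A. x \<in> space X \<Longrightarrow> A \<in> sets X \<Longrightarrow>
      emeasure M {\<omega> \<in> space M. F x (Z n \<omega>) \<in> A} = emeasure (K x) A"
  shows "markov_chain M X K W"
proof -
  note Zm [measurable] = source_measurable(2)[OF indep_Z indep_init]
  note W0 = source_measurable(1)[OF indep_Z indep_init]
  \<comment> \<open>The \<sigma>-algebra \<open>S\<close> is left open: the step is used for
    \<open>M\<close> and again for the past.\<close>
  have step: "W (Suc k) \<in> S \<rightarrow>\<^sub>M X"
    if "space S = space M" "W k \<in> S \<rightarrow>\<^sub>M X" "Z k \<in> S \<rightarrow>\<^sub>M N" for S k
    using measurable_compose[OF measurable_Pair[OF that(2,3)] F]
    by (rule measurable_cong[THEN iffD2, rotated]) (simp add: that(1) recursion)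
  have Wm [measurable]: "W n \<in> M \<rightarrow>\<^sub>M X" for n
    by (induction n) (auto intro: W0 step)
  have cond: "AE \<omega> in M. real_cond_exp M (history M X W n) (\<lambda>\<omega>. indicator A (W (Suc n) \<omega>)) \<omega> =
      measure (K (W n \<omega>)) A" if A [measurable]: "A \<in> sets X" for n A
  proof -
    let ?P = "PiM {..n} (\<lambda>_. X)" and ?H = "\<lambda>\<omega>. \<lambda>i\<in>{..n}. W i \<omega>"
    let ?G = "past M X N (W 0) Z n"
    note past_space = past_space[OF indep_Z indep_init]
    have H [measurable]: "?H \<in> M \<rightarrow>\<^sub>M ?P"
      by (rule measurable_restrict) simp
    have "W k \<in> ?G \<rightarrow>\<^sub>M X" if "k \<le> n" for k
      using that
    proof (induction k)
      case 0
      show ?case by (rule measurable_past_0[OF indep_Z indep_init])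
    next
      case (Suc k)
      then show ?case
        by (intro step past_space measurable_past_innovation[OF indep_Z indep_init]) auto
    qed
    then have HG: "?H \<in> ?G \<rightarrow>\<^sub>M ?P"
      by (intro measurable_restrict) auto
    have "indep_set {?H -` A \<inter> space M |A. A \<in> sets ?P} {Z n -` C \<inter> space M |C. C \<in> sets N}"
    proof (rule indep_setI)
      fix a b assume "a \<in> {?H -` A \<inter> space M |A. A \<in> sets ?P}" "b \<in> {Z n -` C \<inter> space M |C. C \<in> sets N}"
      then obtain B C where ab: "a = ?H -` B \<inter> space M" "B \<in> sets ?P" "b = Z n -` C \<inter> space M" "C \<in> sets N"
        by blast
      have "a \<in> sets ?G"
        using measurable_sets[OF HG ab(2)] by (simp add: ab(1) past_space)
      with ab show "prob (a \<inter> b) = prob a * prob b"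
        using indep_past[OF indep_Z indep_init] by simp
    qed auto
    then have ind: "indep_pair M ?P ?H N (Z n)"
      by (simp add: indep_pair_def H)
    have space_H: "?H \<in> space M \<rightarrow> space ?P"
      using measurable_space[OF H] by blast
    have sub: "subalgebra M (history M X W n)"
      unfolding subalgebra_def history_def sets_vimage_algebra2[OF space_H]
      by auto
    interpret finite_measure_subalgebra M "history M X W n"
      by unfold_locales (rule sub)
    have [measurable]: "K \<in> X \<rightarrow>\<^sub>M subprob_algebra X"
      by (rule markov_kernelD(2)[OF K])
    have K_le: "measure (K (W n \<omega>)) A \<le> 1" if "\<omega> \<in> space M" for \<omega>
      using markov_kernelD(3)[OF K measurable_space[OF Wm that]] by (rule prob_space.prob_le_1)
    have eK: "emeasure (K x) A = ennreal (measure (K x) A)" if "x \<in> space X" for x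
      using markov_kernelD(3)[OF K that] by (simp add: prob_space_def finite_measure.emeasure_eq_measure)
    show ?thesis
    proof (rule real_cond_exp_charact)
      fix B assume "B \<in> sets (history M X W n)"
      then obtain B' where B': "B = ?H -` B' \<inter> space M" and [measurable]: "B' \<in> sets ?P"
        unfolding history_def sets_vimage_algebra2[OF space_H] by blast
      have [measurable]: "B \<in> events"
        unfolding B' by measurable
      \<comment> \<open>Both indicators are written as a function of the path up to time
        \<open>n\<close> and the next innovation; \<open>fst p n\<close> is the current
        state.\<close>
      define f :: "_ \<Rightarrow> ennreal" where "f p = indicator B' (fst p) * indicator A (F (fst p n) (snd p))" for p
      have comp: "(\<lambda>p. fst p n) \<in> ?P \<Otimes>\<^sub>M N \<rightarrow>\<^sub>M X"
        by (rule measurable_compose[OF measurable_fst measurable_component_singleton]) simp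
      have [measurable]: "(\<lambda>p. F (fst p n) (snd p)) \<in> ?P \<Otimes>\<^sub>M N \<rightarrow>\<^sub>M X"
        using measurable_compose[OF measurable_Pair[OF comp measurable_snd] F] by simp
      have f: "f \<in> borel_measurable (?P \<Otimes>\<^sub>M N)"
        unfolding f_def by measurable
      have "(\<integral>\<^sup>+\<omega>. ennreal (indicator B \<omega> *\<^sub>R indicator A (W (Suc n) \<omega>)) \<partial>M) = (\<integral>\<^sup>+\<omega>. f (?H \<omega>, Z n \<omega>) \<partial>M)"
        by (intro nn_integral_cong) (auto simp: f_def B' recursion split: split_indicator)
      \<comment> \<open>Independence replaces the innovation by a copy, after which the inner
        integral is a probability under \<open>K (W n \<omega>)\<close>.\<close>
      also have "\<dots> = (\<integral>\<^sup>+\<omega>. (\<integral>\<^sup>+\<omega>'. f (?H \<omega>, Z n \<omega>') \<partial>M) \<partial>M)"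
        by (rule nn_integral_indep_pair[OF prob_space_axioms ind f])
      also have "\<dots> = (\<integral>\<^sup>+\<omega>. ennreal (indicator B \<omega> *\<^sub>R measure (K (W n \<omega>)) A) \<partial>M)"
      proof (rule nn_integral_cong)
        fix \<omega> assume \<omega>: "\<omega> \<in> space M"
        then have x: "W n \<omega> \<in> space X"
          by (rule measurable_space[OF Wm])
        have [measurable]: "(\<lambda>\<omega>'. F (W n \<omega>) (Z n \<omega>')) \<in> M \<rightarrow>\<^sub>M X"
          using measurable_compose[OF measurable_Pair[OF measurable_const[OF x] Zm] F] by simp
        have "(\<integral>\<^sup>+\<omega>'. f (?H \<omega>, Z n \<omega>') \<partial>M) =
            (\<integral>\<^sup>+\<omega>'. indicator B \<omega> * indicator {\<omega>' \<in> space M. F (W n \<omega>) (Z n \<omega>') \<in> A} \<omega>' \<partial>M)"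
          using \<omega> by (intro nn_integral_cong) (auto simp: f_def B' split: split_indicator)
        also have "\<dots> = indicator B \<omega> * emeasure (K (W n \<omega>)) A"
          by (subst nn_integral_cmult_indicator) (simp_all add: law[OF x A])
        finally show "(\<integral>\<^sup>+\<omega>'. f (?H \<omega>, Z n \<omega>') \<partial>M) = ennreal (indicator B \<omega> *\<^sub>R measure (K (W n \<omega>)) A)"
          by (simp add: eK[OF x] split: split_indicator)
      qed
      finally show "(\<integral>\<omega>\<in>B. indicator A (W (Suc n) \<omega>) \<partial>M) = (\<integral>\<omega>\<in>B. measure (K (W n \<omega>)) A \<partial>M)"
        unfolding set_lebesgue_integral_def by (simp add: integral_eq_nn_integral)
    next
      show "integrable M (\<lambda>\<omega>. indicator A (W (Suc n) \<omega>) :: real)"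
        by (rule integrable_const_bound[where B = 1]) (auto split: split_indicator)
      show "integrable M (\<lambda>\<omega>. measure (K (W n \<omega>)) A)"
        by (rule integrable_const_bound[where B = 1]) (auto simp: K_le)
      have "(\<lambda>\<omega>. ?H \<omega> n) \<in> history M X W n \<rightarrow>\<^sub>M X"
        unfolding history_def
        by (rule measurable_compose[OF measurable_vimage_algebra1[OF space_H] measurable_component_singleton]) simp
      then have [measurable]: "W n \<in> history M X W n \<rightarrow>\<^sub>M X"
        by simp
      show "(\<lambda>\<omega>. measure (K (W n \<omega>)) A) \<in> borel_measurable (history M X W n)"
        by measurable
    qed
  qed
  show ?thesis
    unfolding markov_chain_def using K Wm cond prob_space_axioms by blast
qed

end

text \<open>The first conjunct ties the process to the kernel by reading the recursion as one driven
  by independent innovations; the second is the abstract criterion with atom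
  \<open>zero_vec r\<close>.\<close>

theorem proposition5p1:
  fixes r :: nat and q :: real and M :: "'a measure"
    and D :: "(real \<times> real) measure"
    and U V :: "nat \<Rightarrow> 'a \<Rightarrow> real"
    and clear :: "nat \<Rightarrow> 'a \<Rightarrow> bool"
    and W :: "nat \<Rightarrow> 'a \<Rightarrow> nat \<Rightarrow> real"
  assumes "r > 1" and "0 < q" and "q < 1"
    and "prob_space M"
    and nonneg: "\<And>n \<omega>. \<omega> \<in> space M \<Longrightarrow> 0 \<le> U n \<omega> \<and> 0 \<le> V n \<omega>"
    and ident: "\<And>n. distr M (borel \<Otimes>\<^sub>M borel) (\<lambda>\<omega>. (U n \<omega>, V n \<omega>)) = D"
    and clear_prob: "\<And>n. measure M {\<omega> \<in> space M. clear n \<omega>} = q"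
    and clear_indep: "\<And>n. indep_pair M (count_space UNIV) (clear n)
                   (borel \<Otimes>\<^sub>M borel) (\<lambda>\<omega>. (U n \<omega>, V n \<omega>))"
    and indep: "prob_space.indep_vars M (\<lambda>_. count_space UNIV \<Otimes>\<^sub>M (borel \<Otimes>\<^sub>M borel))
                   (\<lambda>n \<omega>. (clear n \<omega>, (U n \<omega>, V n \<omega>))) UNIV"
    and init_indep: "indep_pair M (workload_space r) (W 0)
                   (PiM UNIV (\<lambda>_. count_space UNIV \<Otimes>\<^sub>M (borel \<Otimes>\<^sub>M borel)))
                   (\<lambda>\<omega> n. (clear n \<omega>, (U n \<omega>, V n \<omega>)))"
    and recursion: "\<And>n \<omega>. \<omega> \<in> space M \<Longrightarrow>
                   W (Suc n) \<omega> = (if clear n \<omega> then zero_vec r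
                                  else queue_step r (U n \<omega>) (V n \<omega>) (W n \<omega>))"
  shows "markov_chain M (workload_space r) (clearing_kernel r q D) W
       \<and> harris_ergodic (workload_space r) (clearing_kernel r q D)"
proof -
  interpret M: prob_space M by fact
  let ?X = "workload_space r" and ?K = "clearing_kernel r q D" and ?B = "borel \<Otimes>\<^sub>M borel :: (real \<times> real) measure"
  let ?N = "count_space UNIV \<Otimes>\<^sub>M ?B :: (bool \<times> real \<times> real) measure"
  \<comment> \<open>One innovation bundles the clearing decision with the interarrival and service
    times.\<close>
  define F where "F x p = (if fst p then zero_vec r else queue_step r (fst (snd p)) (snd (snd p)) x)"
    for x :: "nat \<Rightarrow> real" and p :: "bool \<times> real \<times> real"
  have r: "r > 0" and q: "0 \<le> q" "q \<le> 1"
    using assms(1-3) by simp_all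
  have UV [measurable]: "(\<lambda>\<omega>. (U n \<omega>, V n \<omega>)) \<in> M \<rightarrow>\<^sub>M ?B"
    and clear [measurable]: "clear n \<in> M \<rightarrow>\<^sub>M count_space UNIV" for n
    using clear_indep[of n] by (simp_all add: indep_pair_def)
  have D: "prob_space D" "sets D = sets ?B"
    using M.prob_space_distr[OF UV[of 0]] by (simp_all flip: ident[of 0])
  have K: "markov_kernel ?X ?K"
    by (rule markov_kernel_clearing_kernel[OF r D])
  note mixture = nn_integral_clearing_kernel[OF r D q]
  have step [measurable]: "(\<lambda>p. queue_step r (fst (snd (snd p))) (snd (snd (snd p))) (fst p)) \<in> ?X \<Otimes>\<^sub>M ?N \<rightarrow>\<^sub>M ?X"
    by (rule measurable_queue_step[OF r]) measurable
  have F: "(\<lambda>(x, p). F x p) \<in> ?X \<Otimes>\<^sub>M ?N \<rightarrow>\<^sub>M ?X"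
    unfolding F_def split_beta
    by (rule measurable_If) (auto simp: zero_vec_in_workload_space)
  have "markov_chain M ?X ?K W"
  proof (rule M.markov_chain_random_recursion[where F = F, OF K indep, where W = W, OF init_indep F])
    show "W (Suc n) \<omega> = F (W n \<omega>) (clear n \<omega>, U n \<omega>, V n \<omega>)" if "\<omega> \<in> space M" for n \<omega>
      using recursion[OF that] by (simp add: F_def)
    fix n x A assume x: "x \<in> space ?X" and A [measurable]: "A \<in> sets ?X"
    have Fx [measurable]: "F x \<in> ?N \<rightarrow>\<^sub>M ?X"
      using measurable_compose[OF measurable_Pair[OF measurable_const[OF x] measurable_ident] F] by simp
    let ?J = "\<integral>\<^sup>+y. indicator A y \<partial>queue_kernel r D x"
    have Dstep [measurable]: "(\<lambda>(u, v). queue_step r u v x) \<in> ?B \<rightarrow>\<^sub>M ?X"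
      unfolding split_beta by (rule measurable_queue_step[OF r]) (use x in measurable)
    \<comment> \<open>The decision \<open>b\<close> is frozen here; only the pair
      \<open>(U n, V n)\<close> is integrated.\<close>
    have J: "(\<integral>\<^sup>+\<omega>. indicator A (F x (b, U n \<omega>, V n \<omega>)) \<partial>M) = (if b then indicator A (zero_vec r) else ?J)" for b
    proof -
      have "?J = (\<integral>\<^sup>+\<omega>. indicator A (queue_step r (U n \<omega>) (V n \<omega>) x) \<partial>M)"
        unfolding queue_kernel_def ident[of n, symmetric]
        by (subst nn_integral_distr, simp, simp, subst nn_integral_distr) (simp_all add: split_beta)
      then show ?thesis
        by (simp add: F_def M.emeasure_space_1)
    qed
    have clr: "emeasure M {\<omega> \<in> space M. clear n \<omega>} = ennreal q"
      by (simp add: M.emeasure_eq_measure clear_prob)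
    have nclr: "emeasure M {\<omega> \<in> space M. \<not> clear n \<omega>} = ennreal (1 - q)"
      using M.prob_neg[of "clear n"] by (simp add: M.emeasure_eq_measure clear_prob)
    have "emeasure M {\<omega> \<in> space M. F x (clear n \<omega>, U n \<omega>, V n \<omega>) \<in> A} =
        (\<integral>\<^sup>+\<omega>. indicator A (F x (clear n \<omega>, U n \<omega>, V n \<omega>)) \<partial>M)"
      by (auto simp flip: nn_integral_indicator intro!: nn_integral_cong split: split_indicator)
    \<comment> \<open>Independence of the decision from the pair at the same time \<open>n\<close>
      separates the two integrations, leading to the mixture with weights \<open>q\<close> and
      \<open>1 - q\<close>.\<close>
    also have "\<dots> = (\<integral>\<^sup>+\<omega>. (\<integral>\<^sup>+\<omega>'. indicator A (F x (clear n \<omega>, U n \<omega>', V n \<omega>')) \<partial>M) \<partial>M)"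
      using nn_integral_indep_pair[OF assms(4) clear_indep[of n], of "\<lambda>p. indicator A (F x p)"] by simp
    also have "\<dots> = (\<integral>\<^sup>+\<omega>. indicator A (zero_vec r) * indicator {\<omega> \<in> space M. clear n \<omega>} \<omega> +
        ?J * indicator {\<omega> \<in> space M. \<not> clear n \<omega>} \<omega> \<partial>M)"
      unfolding J by (intro nn_integral_cong) simp
    also have "\<dots> = indicator A (zero_vec r) * ennreal q + ?J * ennreal (1 - q)"
      by (subst nn_integral_add) (simp_all add: nn_integral_cmult_indicator clr nclr del: nn_integral_indicator)
    also have "\<dots> = (\<integral>\<^sup>+y. indicator A y \<partial>?K x)"
      using mixture[of "indicator A" x] x by (simp add: mult.commute)
    also have "\<dots> = emeasure (?K x) A"
      by (simp add: markov_kernelD(4)[OF K x])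
    finally show "emeasure M {\<omega> \<in> space M. F x (clear n \<omega>, U n \<omega>, V n \<omega>) \<in> A} = emeasure (?K x) A" .
  qed
  moreover have "harris_ergodic ?X ?K"
    by (rule harris_ergodic_mixture[OF K markov_kernel_queue_kernel[OF r D] zero_vec_in_workload_space
          assms(2) q(2) mixture assms(3)])
  ultimately show ?thesis ..
qed

end
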